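(* Let $p\ge 0$ be an integer. With $\mathcal{M}_{2p+6,f}=(\mathbb{R}^{2p+6},g_{2p+6,f})$ as defined in the context, set $\mathcal{M}^1_{2p+6}:=\mathcal{M}_{2p+6,f}$ for $f(y)=e^y$ and $\mathcal{M}^2_{2p+6}:=\mathcal{M}_{2p+6,f}$ for $f(y)=e^y+e^{2y}$. Then: 1. $\mathcal{M}^1_{2p+6}$ is a homogeneous space (its isometry group acts transitively). 2. $\mathcal{M}^2_{2p+6}$ is $(p+2)$-modeled on $\mathcal{M}^1_{2p+6}$. 3. $\mathcal{M}^2_{2p+6}$ is not affine $(p+3)$-curvature homogeneous.
   Context: Manifold. Let $(x,y,z_0,\dots,z_p,\bar x,\bar y,\bar z_0,\dots,\bar z_p)$ be coordinates on $\mathbb{R}^{2p+6}$. For smooth $f=f(y)$ put $F_{2p+6,f}(y,\vec z)=f(y)+yz_0+y^2z_1+\dots+y^{p+1}z_p$. The metric $g_{2p+6,f}$, of neutral signature $(p+3,p+3)$, is the symmetric tensor whose only non-zero components (up to symmetry) are $g(\partial_{z_i},\partial_{\bar z_j})=\delta_{ij}$, $g(\partial_x,\partial_{\bar x})=1$, $g(\partial_y,\partial_{\bar y})=1$, $g(\partial_x,\partial_x)=-2F_{2p+6,f}(y,\vec z)$. $k$-modeled. A pseudo-Riemannian manifold $M$ is $k$-modeled on a homogeneous pseudo-Riemannian manifold $N$ if for every $P\in M$ and $Q\in N$ there is a linear isomorphism $\phi:T_PM\to T_QN$ with $\phi^*(g_N)_Q=(g_M)_P$ and $\phi^*(\nabla^iR_N)_Q=(\nabla^iR_M)_P$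 for $0\le i\le k$, where $R$ is the curvature tensor and $\nabla^iR$ its $i$-th covariant derivative. Affine curvature homogeneity. A pseudo-Riemannian manifold $M$ with Levi-Civita connection $\nabla$ and curvature operator $\mathcal{R}(\xi_1,\xi_2)=\nabla_{\xi_1}\nabla_{\xi_2}-\nabla_{\xi_2}\nabla_{\xi_1}-\nabla_{[\xi_1,\xi_2]}$ is affine $k$-curvature homogeneous if for any $P,Q\in M$ there is a linear isomorphism $\phi:T_PM\to T_QM$ (not required to be an isometry) with $\phi^*\nabla^i\mathcal{R}_Q=\nabla^i\mathcal{R}_P$ for $0\le i\le k$. *)

theory Defs
  imports "HOL-Analysis.Analysis"
begin

text \<open>
  All manifolds here have a single global chart, so a manifold is a Euclidean space \<open>'a\<close> with a
  metric, every tangent space is identified with \<open>'a\<close>, and a vector field is a function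
  \<open>'a \<Rightarrow> 'a\<close>.
\<close>

type_synonym 'a metric = "'a \<Rightarrow> 'a \<Rightarrow> 'a \<Rightarrow> real"

text \<open>C-infinity: all iterated directional derivatives exist and are Frechet differentiable.\<close>

definition smooth :: "('a::euclidean_space \<Rightarrow> 'b::euclidean_space) \<Rightarrow> bool" where
  "smooth h \<longleftrightarrow>
     (\<forall>us P. foldr (\<lambda>u k Q. frechet_derivative k (at Q) u) us h differentiable (at P))"

definition lie_bracket ::
    "('a::euclidean_space \<Rightarrow> 'a) \<Rightarrow> ('a \<Rightarrow> 'a) \<Rightarrow> 'a \<Rightarrow> 'a" where
  "lie_bracket X Y P =
     frechet_derivative Y (at P) (X P) - frechet_derivative X (at P) (Y P)"

text \<open>
  Every affine connection on \<open>'a\<close> is the flat connection plus a field \<open>\<Gamma>\<close> of bilinear maps (its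
  Christoffel symbols in the global chart).
\<close>

definition connection_of ::
    "('a::euclidean_space \<Rightarrow> 'a \<Rightarrow> 'a \<Rightarrow> 'a) \<Rightarrow> ('a \<Rightarrow> 'a) \<Rightarrow> ('a \<Rightarrow> 'a) \<Rightarrow> 'a \<Rightarrow> 'a" where
  "connection_of \<Gamma> X Y P = frechet_derivative Y (at P) (X P) + \<Gamma> P (X P) (Y P)"

text \<open>
  Torsion-free and metric. For a smooth non-degenerate symmetric \<open>g\<close> there is exactly one such
  \<open>\<Gamma>\<close>, and it depends smoothly on the point.
\<close>

definition is_levi_civita ::
    "'a::euclidean_space metric \<Rightarrow> ('a \<Rightarrow> 'a \<Rightarrow> 'a \<Rightarrow> 'a) \<Rightarrow> bool" where
  "is_levi_civita g \<Gamma> \<longleftrightarrow>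
     (\<forall>P. bilinear (\<Gamma> P)) \<and>
     (\<forall>X Y P. smooth X \<longrightarrow> smooth Y \<longrightarrow>
        connection_of \<Gamma> X Y P - connection_of \<Gamma> Y X P = lie_bracket X Y P) \<and>
     (\<forall>X Y Z P. smooth X \<longrightarrow> smooth Y \<longrightarrow> smooth Z \<longrightarrow>
        frechet_derivative (\<lambda>Q. g Q (Y Q) (Z Q)) (at P) (X P) =
          g P (connection_of \<Gamma> X Y P) (Z P) + g P (Y P) (connection_of \<Gamma> X Z P))"

definition nabla ::
    "'a::euclidean_space metric \<Rightarrow> ('a \<Rightarrow> 'a) \<Rightarrow> ('a \<Rightarrow> 'a) \<Rightarrow> 'a \<Rightarrow> 'a" where
  "nabla g = connection_of (THE \<Gamma>. is_levi_civita g \<Gamma>)"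

definition curvature_operator ::
    "'a::euclidean_space metric \<Rightarrow> ('a \<Rightarrow> 'a) \<Rightarrow> ('a \<Rightarrow> 'a) \<Rightarrow> ('a \<Rightarrow> 'a) \<Rightarrow> 'a \<Rightarrow> 'a" where
  "curvature_operator g X Y Z P =
     nabla g X (nabla g Y Z) P - nabla g Y (nabla g X Z) P - nabla g (lie_bracket X Y) Z P"

text \<open>
  A tensor field with \<open>m\<close> covariant slots takes a point and a list of \<open>m\<close> tangent vectors; only
  its values on lists of that length are meaningful. Its values are reals for type \<open>(0,m)\<close> and
  tangent vectors for type \<open>(1,m)\<close>. By tensoriality, tangent vectors may be extended to constant
  vector fields.
\<close>

definition curv13 :: "'a::euclidean_space metric \<Rightarrow> 'a \<Rightarrow> 'a list \<Rightarrow> 'a" where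
  "curv13 g P us = curvature_operator g (\<lambda>_. us ! 0) (\<lambda>_. us ! 1) (\<lambda>_. us ! 2) P"

definition curv04 :: "'a::euclidean_space metric \<Rightarrow> 'a \<Rightarrow> 'a list \<Rightarrow> real" where
  "curv04 g P us = g P (curv13 g P us) (us ! 3)"

text \<open>
  Covariant derivatives of tensor fields; the direction of differentiation is put in the first
  slot.
\<close>

fun cov_deriv_scalar ::
    "'a::euclidean_space metric \<Rightarrow> ('a \<Rightarrow> 'a list \<Rightarrow> real) \<Rightarrow> 'a \<Rightarrow> 'a list \<Rightarrow> real" where
  "cov_deriv_scalar g T P [] = 0"
| "cov_deriv_scalar g T P (v # us) =
     frechet_derivative (\<lambda>Q. T Q us) (at P) v
     - (\<Sum>j<length us. T P (us[j := nabla g (\<lambda>_. v) (\<lambda>_. us ! j) P]))"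

fun cov_deriv_vector ::
    "'a::euclidean_space metric \<Rightarrow> ('a \<Rightarrow> 'a list \<Rightarrow> 'a) \<Rightarrow> 'a \<Rightarrow> 'a list \<Rightarrow> 'a" where
  "cov_deriv_vector g T P [] = 0"
| "cov_deriv_vector g T P (v # us) =
     nabla g (\<lambda>_. v) (\<lambda>Q. T Q us) P
     - (\<Sum>j<length us. T P (us[j := nabla g (\<lambda>_. v) (\<lambda>_. us ! j) P]))"

definition nabla_curv04 :: "nat \<Rightarrow> 'a::euclidean_space metric \<Rightarrow> 'a \<Rightarrow> 'a list \<Rightarrow> real" where
  "nabla_curv04 i g = (cov_deriv_scalar g ^^ i) (curv04 g)"

definition nabla_curv13 :: "nat \<Rightarrow> 'a::euclidean_space metric \<Rightarrow> 'a \<Rightarrow> 'a list \<Rightarrow> 'a" where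
  "nabla_curv13 i g = (cov_deriv_vector g ^^ i) (curv13 g)"

definition is_isometry :: "'a::euclidean_space metric \<Rightarrow> ('a \<Rightarrow> 'a) \<Rightarrow> bool" where
  "is_isometry g \<phi> \<longleftrightarrow>
     bij \<phi> \<and> smooth \<phi> \<and> smooth (inv \<phi>) \<and>
     (\<forall>P u v. g (\<phi> P) (frechet_derivative \<phi> (at P) u) (frechet_derivative \<phi> (at P) v) = g P u v)"

definition homogeneous :: "'a::euclidean_space metric \<Rightarrow> bool" where
  "homogeneous g \<longleftrightarrow> (\<forall>P Q. \<exists>\<phi>. is_isometry g \<phi> \<and> \<phi> P = Q)"

definition k_modeled ::
    "nat \<Rightarrow> 'a::euclidean_space metric \<Rightarrow> 'b::euclidean_space metric \<Rightarrow> bool" where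
  "k_modeled k gM gN \<longleftrightarrow>
     homogeneous gN \<and>
     (\<forall>P Q. \<exists>\<phi>. linear \<phi> \<and> bij \<phi> \<and>
        (\<forall>u v. gN Q (\<phi> u) (\<phi> v) = gM P u v) \<and>
        (\<forall>i\<le>k. \<forall>us. length us = i + 4 \<longrightarrow>
           nabla_curv04 i gN Q (map \<phi> us) = nabla_curv04 i gM P us))"

definition affine_curvature_homogeneous ::
    "nat \<Rightarrow> 'a::euclidean_space metric \<Rightarrow> bool" where
  "affine_curvature_homogeneous k g \<longleftrightarrow>
     (\<forall>P Q. \<exists>\<phi>. linear \<phi> \<and> bij \<phi> \<and>
        (\<forall>i\<le>k. \<forall>us. length us = i + 3 \<longrightarrow>
           nabla_curv13 i g Q (map \<phi> us) = \<phi> (nabla_curv13 i g P us)))"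

text \<open>
  Points \<open>(x, y, z, x', y', z')\<close>, primes standing for bars. The index type \<open>'m\<close> of the
  \<open>z\<close>-coordinates has \<open>p + 1\<close> elements, enumerated as \<open>e 0, \<dots>, e p\<close>, so \<open>z\<^sub>i\<close> is \<open>z $ e i\<close>.
\<close>

type_synonym 'm point = "real \<times> real \<times> (real ^ 'm) \<times> real \<times> real \<times> (real ^ 'm)"

definition F_pot ::
    "nat \<Rightarrow> (nat \<Rightarrow> 'm::finite) \<Rightarrow> (real \<Rightarrow> real) \<Rightarrow> real \<Rightarrow> real ^ 'm \<Rightarrow> real" where
  "F_pot p e f y z = f y + (\<Sum>i\<le>p. y ^ (i + 1) * (z $ e i))"

definition g_met ::
    "nat \<Rightarrow> (nat \<Rightarrow> 'm::finite) \<Rightarrow> (real \<Rightarrow> real) \<Rightarrow> 'm point metric" where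
  "g_met p e f = (\<lambda>(x, y, z, x', y', z') (ux, uy, uz, ux', uy', uz') (vx, vy, vz, vx', vy', vz').
     (uz \<bullet> vz' + uz' \<bullet> vz) + (ux * vx' + ux' * vx) + (uy * vy' + uy' * vy)
     - 2 * F_pot p e f y z * ux * vx)"

end

theory Submission imports Defs begin

text \<open>
  Write a point as \<open>(x, w, x', w')\<close> with \<open>w = (y, z)\<close>; the metric is then
  \<open>2 dw dw' + 2 dx dx' - 2 F(w) dx\<^sup>2\<close>. Its Christoffel symbols take values in the barred directions
  \<open>x', w'\<close> and depend on \<open>w\<close> only, so a barred vector inserted into any slot of \<open>\<nabla>\<^sup>i R\<close> gives zero.
  All correction terms of the iterated covariant derivative therefore vanish, and \<open>\<nabla>\<^sup>i R\<close> is an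
  explicit expression in the coordinate derivative \<open>D\<^sup>i\<^sup>+\<^sup>2 F\<close>
  (\<open>nabla_curv13_eq\<close>, \<open>nabla_curv04_eq\<close>).

  For \<open>F = f(y) + q(y) \<bullet> z\<close> with \<open>q(y) = (y, \<dots>, y\<^sup>p\<^sup>+\<^sup>1)\<close>, the vectors \<open>q'(y), \<dots>, q\<^sup>(\<^sup>p\<^sup>+\<^sup>1\<^sup>)(y)\<close> form a
  basis for every \<open>y\<close>, and \<open>q\<^sup>(\<^sup>p\<^sup>+\<^sup>2\<^sup>) = 0\<close>. A linear change of variables
  \<open>(t, \<zeta>) \<mapsto> (\<mu> t, L \<zeta> + t c)\<close> of \<open>w\<close>, together with a scaling of \<open>x\<close> by \<open>\<lambda>\<close>, can thus
  match the mixed \<open>y, z\<close>-derivatives at two points through \<open>L\<close>, and the pure \<open>y\<close>-derivatives of order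
  \<open>2, \<dots>, p + 2\<close> through \<open>c\<close> (\<open>jet_transfer_exists\<close>, \<open>jet_map\<close>). In the orders above \<open>p + 2\<close>
  only \<open>f\<^sup>(\<^sup>n\<^sup>)\<close> survives and is rescaled by \<open>\<lambda>\<^sup>2 \<mu>\<^sup>n\<close>. This has three consequences.

  \<^item> For \<open>f = exp\<close> all these derivatives are equal, so \<open>\<mu> = 1\<close> and one choice of \<open>\<lambda>\<close> matches every
    order at once. Then \<open>\<lambda>\<^sup>2 F\<close> after the change of variables differs from \<open>F\<close> by an affine function,
    and such a difference can be absorbed into \<open>x'\<close> and \<open>w'\<close>: the result is an isometry
    (\<open>is_isometry_pp_metric\<close>) from any point to any other.
  \<^item> Between \<open>e\<^sup>y + e\<^sup>2\<^sup>y\<close> and \<open>e\<^sup>y\<close>, whose derivatives are all positive, the two free scales \<open>\<lambda>, \<mu>\<close>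
    still match the orders \<open>p + 3\<close> and \<open>p + 4\<close>, hence \<open>R, \<dots>, \<nabla>\<^sup>p\<^sup>+\<^sup>2 R\<close> (\<open>linear_model\<close>).
  \<^item> The order \<open>p + 5\<close> is an obstruction: \<open>f\<^sup>(\<^sup>p\<^sup>+\<^sup>3\<^sup>) f\<^sup>(\<^sup>p\<^sup>+\<^sup>5\<^sup>) / (f\<^sup>(\<^sup>p\<^sup>+\<^sup>4\<^sup>))\<^sup>2\<close> does not feel the two scales and
    is an invariant even of the affine curvature model (\<open>affine_invariant\<close>). It is not constant for
    \<open>e\<^sup>y + e\<^sup>2\<^sup>y\<close>.
\<close>

section \<open>Polynomial maps are smooth\<close>

lemma real_polynomial_function_frechet_derivative:
  assumes "real_polynomial_function (h :: 'a::euclidean_space \<Rightarrow> real)"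
  shows "real_polynomial_function (\<lambda>P. frechet_derivative h (at P) u)"
  using assms
proof induction
  case (linear f)
  then have "(\<lambda>P. frechet_derivative f (at P) u) = (\<lambda>_. f u)"
    using bounded_linear_imp_has_derivative frechet_derivative_at by metis
  then show ?case by auto
next
  case (const c)
  then show ?case by (simp add: real_polynomial_function.intros(2))
next
  case (add f g)
  note d = add.hyps[THEN differentiable_at_real_polynomial_function]
  have "frechet_derivative (\<lambda>x. f x + g x) (at P) =
      (\<lambda>v. frechet_derivative f (at P) v + frechet_derivative g (at P) v)" for P
    using d by (intro frechet_derivative_at[symmetric] has_derivative_add)
      (simp_all add: frechet_derivative_works[symmetric])
  then show ?case using add.IH by (simp add: real_polynomial_function.intros(3))
next
  case (mult f g)
  note d = mult.hyps[THEN differentiable_at_real_polynomial_function]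
  have "frechet_derivative (\<lambda>x. f x * g x) (at P) =
      (\<lambda>v. f P * frechet_derivative g (at P) v + frechet_derivative f (at P) v * g P)" for P
    using d by (intro frechet_derivative_at[symmetric] has_derivative_mult)
      (simp_all add: frechet_derivative_works[symmetric])
  moreover have "real_polynomial_function (\<lambda>P. f P * frechet_derivative g (at P) u
      + frechet_derivative f (at P) u * g P)"
    by (rule real_polynomial_function.intros(3)
        [OF real_polynomial_function.intros(4) real_polynomial_function.intros(4)]) fact+
  ultimately show ?case by simp
qed

lemma polynomial_function_frechet_derivative:
  assumes "polynomial_function (h :: 'a::euclidean_space \<Rightarrow> 'b::euclidean_space)"
  shows "polynomial_function (\<lambda>P. frechet_derivative h (at P) u)"
  unfolding polynomial_function_iff_Basis_inner
proof
  fix b :: 'b assume "b \<in> Basis"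
  have "(h has_derivative frechet_derivative h (at P)) (at P)" for P
    using differentiable_at_polynomial_function[OF assms] frechet_derivative_works by blast
  then have "((\<lambda>P. h P \<bullet> b) has_derivative (\<lambda>v. frechet_derivative h (at P) v \<bullet> b)) (at P)" for P
    by (rule has_derivative_inner_left)
  from frechet_derivative_at[OF this]
  have "(\<lambda>P. frechet_derivative h (at P) u \<bullet> b) =
      (\<lambda>P. frechet_derivative (\<lambda>P. h P \<bullet> b) (at P) u)"
    by metis
  moreover have "real_polynomial_function (\<lambda>P. h P \<bullet> b)"
    using assms \<open>b \<in> Basis\<close> polynomial_function_iff_Basis_inner by blast
  ultimately show "real_polynomial_function (\<lambda>P. frechet_derivative h (at P) u \<bullet> b)"
    by (simp add: real_polynomial_function_frechet_derivative)
qed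

text \<open>
  Polynomial maps are closed under directional derivatives and differentiable, which is all that
  smoothness asks for. Both the constant fields that determine the Levi-Civita connection and the
  isometries constructed below are polynomial.
\<close>

lemma smooth_polynomial_function:
  assumes "polynomial_function (h :: 'a::euclidean_space \<Rightarrow> 'b::euclidean_space)"
  shows "smooth h"
proof -
  have "polynomial_function (foldr (\<lambda>u k Q. frechet_derivative k (at Q) u) us h)" for us
    by (induction us) (auto intro: assms polynomial_function_frechet_derivative)
  then show ?thesis
    unfolding smooth_def using differentiable_at_polynomial_function by blast
qed

lemma smooth_const: "smooth (\<lambda>_. c)"
  by (intro smooth_polynomial_function polynomial_function_const)

lemma smooth_has_derivative: "smooth h \<Longrightarrow> (h has_derivative frechet_derivative h (at P)) (at P)"
  unfolding smooth_def frechet_derivative_works[symmetric] by (metis foldr.simps(1) id_apply)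

section \<open>Coordinates and the metric\<close>

type_synonym 'm base = "real \<times> (real ^ 'm)"

text \<open>
  The metric does not distinguish \<open>y\<close> from \<open>z\<close> except through the potential. Grouping each
  pair into one vector \<open>wc\<close> or \<open>wb\<close> of a Euclidean space \<open>base\<close> gives the metric the shape of a
  pp-wave metric with a potential on \<open>base\<close>.
\<close>

definition xc :: "'m::finite point \<Rightarrow> real" where "xc P = fst P"
definition wc :: "'m::finite point \<Rightarrow> 'm base" where "wc P = (fst (snd P), fst (snd (snd P)))"
definition xb :: "'m::finite point \<Rightarrow> real" where "xb P = fst (snd (snd (snd P)))"
definition wb :: "'m::finite point \<Rightarrow> 'm base" where "wb P = snd (snd (snd (snd P)))"
definition mk_pt :: "real \<Rightarrow> 'm::finite base \<Rightarrow> real \<Rightarrow> 'm base \<Rightarrow> 'm point" where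
  "mk_pt x w x' w' = (x, fst w, snd w, x', w')"

lemmas coord_defs = xc_def wc_def xb_def wb_def mk_pt_def

lemma coord_mk_pt [simp]:
  "xc (mk_pt x w x' w') = x" "wc (mk_pt x w x' w') = w"
  "xb (mk_pt x w x' w') = x'" "wb (mk_pt x w x' w') = w'"
  "mk_pt (xc P) (wc P) (xb P) (wb P) = P"
  by (auto simp: coord_defs)

lemma point_eq_iff: "P = Q \<longleftrightarrow> xc P = xc Q \<and> wc P = wc Q \<and> xb P = xb Q \<and> wb P = wb Q"
  by (metis coord_mk_pt(5))

lemma bounded_linear_coord:
  "bounded_linear xc" "bounded_linear wc" "bounded_linear xb" "bounded_linear wb"
  unfolding coord_defs[abs_def]
  by (intro bounded_linear_intros bounded_linear_Pair)+

lemmas coord_simps [simp] =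
  bounded_linear_coord[THEN bounded_linear.linear, THEN linear_add]
  bounded_linear_coord[THEN bounded_linear.linear, THEN linear_diff]
  bounded_linear_coord[THEN bounded_linear.linear, THEN linear_cmul]
  bounded_linear_coord[THEN bounded_linear.linear, THEN linear_0]

lemmas coord_has_derivative [derivative_intros] =
  bounded_linear_coord[THEN bounded_linear.has_derivative]

lemma mk_pt_has_derivative [derivative_intros]:
  assumes "(a has_derivative a') (at P within S)" "(b has_derivative b') (at P within S)"
          "(c has_derivative c') (at P within S)" "(d has_derivative d') (at P within S)"
  shows "((\<lambda>P. mk_pt (a P) (b P) (c P) (d P)) has_derivative
          (\<lambda>v. mk_pt (a' v) (b' v) (c' v) (d' v))) (at P within S)"
  unfolding coord_defs
  by (intro has_derivative_Pair has_derivative_fst has_derivative_snd assms)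

definition pp_metric :: "('m::finite base \<Rightarrow> real) \<Rightarrow> 'm point metric" where
  "pp_metric F P u v =
     wc u \<bullet> wb v + wb u \<bullet> wc v + xc u * xb v + xb u * xc v - 2 * F (wc P) * xc u * xc v"

lemma g_met_eq_pp_metric: "g_met p e f = pp_metric (\<lambda>w. F_pot p e f (fst w) (snd w))"
  by (auto simp: fun_eq_iff g_met_def pp_metric_def coord_defs algebra_simps)

text \<open>
  Testing against the four kinds of coordinate vectors recovers \<open>xc\<close>, \<open>xb\<close>, \<open>wc\<close> and \<open>wb\<close> in turn;
  \<open>xb\<close> comes after \<open>xc\<close> because \<open>\<partial>\<^sub>x\<close> need not be a null vector.
\<close>

lemma pp_metric_nondegenerate:
  assumes "\<And>t. pp_metric F P u t = pp_metric F P v t"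
  shows "u = v"
proof -
  have 1: "xc u = xc v" using assms[of "mk_pt 0 0 1 0"] by (simp add: pp_metric_def)
  have 2: "xb u = xb v" using assms[of "mk_pt 1 0 0 0"] 1 by (simp add: pp_metric_def)
  have "wc u \<bullet> b = wc v \<bullet> b" for b using assms[of "mk_pt 0 0 0 b"] by (simp add: pp_metric_def)
  then have 3: "wc u = wc v" by (metis inner_commute vector_eq_rdot)
  have "wb u \<bullet> b = wb v \<bullet> b" for b
    using assms[of "mk_pt 0 b 0 0"] by (simp add: pp_metric_def)
  then have 4: "wb u = wb v" by (metis inner_commute vector_eq_rdot)
  show ?thesis using 1 2 3 4 point_eq_iff by blast
qed

section \<open>The Levi-Civita connection and the covariant derivatives of curvature\<close>

text \<open>
  For fixed first arguments, the values of \<open>\<nabla>\<^sup>i R\<close> all have this form: \<open>curv_apply d\<close> is the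
  skew-adjoint endomorphism built from a vector \<open>d\<close> of \<open>base\<close>.
\<close>

definition curv_apply :: "'m::finite base \<Rightarrow> 'm point \<Rightarrow> 'm point" where
  "curv_apply d c = mk_pt 0 0 (- (d \<bullet> wc c)) (xc c *\<^sub>R d)"

lemma curv_apply_has_derivative [derivative_intros]:
  assumes "(h has_derivative h') (at P)"
  shows "((\<lambda>P. curv_apply (h P) c) has_derivative (\<lambda>v. curv_apply (h' v) c)) (at P)"
  unfolding curv_apply_def by (rule derivative_eq_intros assms refl | simp)+

lemma split_off_three:
  assumes "length us = n + 3"
  obtains vs a b c where "us = vs @ [a, b, c]" "length vs = n"
proof -
  have "length (drop n us) = 3" using assms by simp
  then obtain a b c where "drop n us = [a, b, c]"
    by (auto simp: numeral_3_eq_3 length_Suc_conv simp del: length_drop)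
  then have "us = take n us @ [a, b, c]" by (metis append_take_drop_id)
  moreover have "length (take n us) = n" using assms by simp
  ultimately show ?thesis by (rule that)
qed

lemma split_off_four:
  assumes "length us = n + 4"
  obtains vs a b c d where "us = vs @ [a, b, c, d]" "length vs = n"
proof -
  obtain vs b c d where 1: "us = vs @ [b, c, d]" "length vs = Suc n"
    by (rule split_off_three[of us "Suc n"]) (use assms in auto)
  then obtain ws a where "vs = ws @ [a]" "length ws = n" by (auto simp: length_Suc_conv_rev)
  then show ?thesis using 1 that by simp
qed

text \<open>
  A potential together with all its derivatives: \<open>G w [u\<^sub>1, \<dots>, u\<^sub>n]\<close> is the gradient at \<open>w\<close> of the
  function \<open>D\<^sup>n F (u\<^sub>1, \<dots>, u\<^sub>n)\<close>, so that \<open>G w [u\<^sub>1, \<dots>, u\<^sub>n] \<bullet> t = D\<^sup>n\<^sup>+\<^sup>1 F (u\<^sub>1, \<dots>, u\<^sub>n, t)\<close>. The last two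
  assumptions record the symmetry and multilinearity of these derivatives as far as the curvature
  computation draws on them.
\<close>

locale derivative_tower =
  fixes F :: "'m::finite base \<Rightarrow> real" and G :: "'m base \<Rightarrow> 'm base list \<Rightarrow> 'm base"
  assumes F_has_derivative: "\<And>w. (F has_derivative (\<lambda>v. G w [] \<bullet> v)) (at w)"
    and G_has_derivative: "\<And>w ws. ((\<lambda>w. G w ws) has_derivative (\<lambda>v. G w (v # ws))) (at w)"
    and G_sym: "\<And>w a b. G w [a] \<bullet> b = G w [b] \<bullet> a"
    and G_zero: "\<And>w ws. 0 \<in> set ws \<Longrightarrow> G w ws = 0"
begin

definition christoffel :: "'m point \<Rightarrow> 'm point \<Rightarrow> 'm point \<Rightarrow> 'm point" where
  "christoffel P u v =
     mk_pt 0 0 (- (xc u * (G (wc P) [] \<bullet> wc v) + xc v * (G (wc P) [] \<bullet> wc u)))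
       ((xc u * xc v) *\<^sub>R G (wc P) [])"

lemma F_wc_has_derivative [derivative_intros]:
  "((\<lambda>P. F (wc P)) has_derivative (\<lambda>v. G (wc P) [] \<bullet> wc v)) (at P)"
  using has_derivative_compose[OF coord_has_derivative(2)[OF has_derivative_ident] F_has_derivative] .

lemma G_wc_has_derivative [derivative_intros]:
  "((\<lambda>P. G (wc P) ws) has_derivative (\<lambda>v. G (wc P) (wc v # ws))) (at P)"
  using has_derivative_compose[OF coord_has_derivative(2)[OF has_derivative_ident] G_has_derivative] .

lemma bilinear_christoffel: "bilinear (christoffel P)"
  unfolding bilinear_def
  by (intro conjI allI linearI)
    (simp_all only: point_eq_iff, simp_all add: christoffel_def algebra_simps inner_add_right)

lemma christoffel_symmetric: "christoffel P u v = christoffel P v u"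
  by (simp add: christoffel_def algebra_simps)

lemma levi_civita_christoffel: "is_levi_civita (pp_metric F) christoffel"
  unfolding is_levi_civita_def
proof (intro conjI allI impI)
  show "bilinear (christoffel P)" for P by (rule bilinear_christoffel)
next
  fix X Y :: "'m point \<Rightarrow> 'm point" and P
  show "connection_of christoffel X Y P - connection_of christoffel Y X P = lie_bracket X Y P"
    unfolding connection_of_def lie_bracket_def by (simp add: christoffel_symmetric)
next
  fix X Y Z :: "'m point \<Rightarrow> 'm point" and P
  assume "smooth Y" "smooth Z"
  note [derivative_intros] = \<open>smooth Y\<close>[THEN smooth_has_derivative] \<open>smooth Z\<close>[THEN smooth_has_derivative]
  let ?dY = "frechet_derivative Y (at P)" and ?dZ = "frechet_derivative Z (at P)"
  have "((\<lambda>Q. pp_metric F Q (Y Q) (Z Q)) has_derivative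
     (\<lambda>v. pp_metric F P (?dY v) (Z P) + pp_metric F P (Y P) (?dZ v)
          - 2 * (G (wc P) [] \<bullet> wc v) * xc (Y P) * xc (Z P))) (at P)"
    unfolding pp_metric_def
    by (rule derivative_eq_intros refl | simp add: fun_eq_iff algebra_simps)+
  from frechet_derivative_at[OF this, symmetric]
  show "frechet_derivative (\<lambda>Q. pp_metric F Q (Y Q) (Z Q)) (at P) (X P) =
       pp_metric F P (connection_of christoffel X Y P) (Z P) +
       pp_metric F P (Y P) (connection_of christoffel X Z P)"
    by (simp add: connection_of_def christoffel_def pp_metric_def algebra_simps inner_add_right
        inner_commute)
qed

text \<open>
  Constant vector fields are smooth and their brackets vanish, so symmetry and metric compatibility
  yield the Koszul formula for \<open>\<Gamma>\<close> at each point, and the metric is non-degenerate.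
\<close>

lemma levi_civita_unique:
  assumes "is_levi_civita (pp_metric F) \<Gamma>"
  shows "\<Gamma> = christoffel"
proof -
  have koszul: "2 * pp_metric F P (\<Gamma> P u v) t =
      frechet_derivative (\<lambda>Q. pp_metric F Q v t) (at P) u
      + frechet_derivative (\<lambda>Q. pp_metric F Q u t) (at P) v
      - frechet_derivative (\<lambda>Q. pp_metric F Q u v) (at P) t"
    if lc: "is_levi_civita (pp_metric F) \<Gamma>" for \<Gamma> P u v t
  proof -
    have sym: "\<Gamma> P a b = \<Gamma> P b a" for a b
      using lc[unfolded is_levi_civita_def, THEN conjunct2, THEN conjunct1, rule_format,
          OF smooth_const smooth_const, of a b P]
      by (simp add: connection_of_def lie_bracket_def)
    have met: "frechet_derivative (\<lambda>Q. pp_metric F Q b c) (at P) a =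
        pp_metric F P (\<Gamma> P a b) c + pp_metric F P b (\<Gamma> P a c)" for a b c
      using lc[unfolded is_levi_civita_def, THEN conjunct2, THEN conjunct2, rule_format,
          OF smooth_const smooth_const smooth_const, of b c P a]
      by (simp add: connection_of_def)
    have com: "pp_metric F P a b = pp_metric F P b a" for a b
      by (simp add: pp_metric_def inner_commute algebra_simps)
    show ?thesis
      unfolding met using sym[of u v] sym[of u t] sym[of v t] com by simp
  qed
  have "pp_metric F P (\<Gamma> P u v) t = pp_metric F P (christoffel P u v) t" for P u v t
    using koszul[OF assms, of P u v t] koszul[OF levi_civita_christoffel, of P u v t] by simp
  then show ?thesis
    by (intro ext) (rule pp_metric_nondegenerate)
qed

lemma nabla_eq: "nabla (pp_metric F) = connection_of christoffel"
  unfolding nabla_def using the_equality[of "is_levi_civita (pp_metric F)" christoffel]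
    levi_civita_christoffel levi_civita_unique by metis

lemma nabla_const: "nabla (pp_metric F) (\<lambda>_. u) (\<lambda>_. v) = (\<lambda>P. christoffel P u v)"
  by (simp add: nabla_eq connection_of_def fun_eq_iff)

text \<open>
  The Christoffel symbols vanish on barred vectors, so the covariant derivative of a barred field is
  its coordinate derivative.
\<close>

lemma nabla_barred:
  assumes "(T has_derivative T') (at P)" "xc (T P) = 0" "wc (T P) = 0"
  shows "nabla (pp_metric F) (\<lambda>_. v) T P = T' v"
  using frechet_derivative_at[OF assms(1)] assms
  by (auto simp: nabla_eq connection_of_def christoffel_def point_eq_iff)

text \<open>
  The list \<open>vs\<close> holds the directions of covariant differentiation, \<open>a\<close> and \<open>b\<close> the first two
  arguments of the curvature operator.
\<close>

definition curv_form :: "'m point \<Rightarrow> 'm point list \<Rightarrow> 'm point \<Rightarrow> 'm point \<Rightarrow> 'm base" where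
  "curv_form P vs a b =
     xc b *\<^sub>R G (wc P) (map wc vs @ [wc a]) - xc a *\<^sub>R G (wc P) (map wc vs @ [wc b])"

lemma curv_form_has_derivative [derivative_intros]:
  "((\<lambda>P. curv_form P vs a b) has_derivative (\<lambda>v. curv_form P (v # vs) a b)) (at P)"
  unfolding curv_form_def by (rule derivative_eq_intros refl | simp)+

text \<open>
  Quadratic terms in \<open>\<Gamma>\<close> do not occur since \<open>\<Gamma>\<close> is barred and vanishes on barred vectors; the
  curvature is the antisymmetrised derivative of \<open>\<Gamma>\<close>, where the part containing \<open>D\<^sup>2 F(a, b)\<close> cancels
  by symmetry.
\<close>

lemma curv13_eq: "curv13 (pp_metric F) P [a, b, c] = curv_apply (curv_form P [] a b) c"
proof -
  have d: "((\<lambda>Q. christoffel Q v c) has_derivative (\<lambda>u. mk_pt 0 0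
        (- (xc v * (G (wc P) [wc u] \<bullet> wc c) + xc c * (G (wc P) [wc u] \<bullet> wc v)))
        ((xc v * xc c) *\<^sub>R G (wc P) [wc u]))) (at P)" for v
    unfolding christoffel_def by (rule derivative_eq_intros refl | simp)+
  have barred: "xc (christoffel P v c) = 0" "wc (christoffel P v c) = 0" for v
    by (simp_all add: christoffel_def)
  have "lie_bracket (\<lambda>_. a) (\<lambda>_. b) = (\<lambda>_. 0)"
    by (simp only: lie_bracket_def fun_eq_iff) simp
  moreover have "christoffel P 0 c = 0"
    by (simp only: point_eq_iff) (simp add: christoffel_def)
  ultimately have "curv13 (pp_metric F) P [a, b, c] =
      nabla (pp_metric F) (\<lambda>_. a) (\<lambda>Q. christoffel Q b c) P
      - nabla (pp_metric F) (\<lambda>_. b) (\<lambda>Q. christoffel Q a c) P"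
    by (simp add: curv13_def curvature_operator_def nabla_const)
  also have "\<dots> = curv_apply (curv_form P [] a b) c"
    unfolding nabla_barred[OF d barred]
    by (simp only: point_eq_iff)
      (simp add: curv_apply_def curv_form_def algebra_simps inner_diff_left
        G_sym[of _ "wc b" "wc a"])
  finally show ?thesis .
qed

lemma curv_form_eq_0:
  assumes "xc \<beta> = 0" "wc \<beta> = 0" "\<beta> \<in> set vs \<or> \<beta> = a \<or> \<beta> = b"
  shows "curv_form P vs a b = 0"
proof -
  have "0 \<in> wc ` set vs \<or> xc a = 0 \<and> wc a = 0 \<or> xc b = 0 \<and> wc b = 0"
    using assms by (metis image_eqI)
  then show ?thesis by (auto simp: curv_form_def G_zero)
qed

text \<open>
  Every correction term of the covariant derivative inserts a barred vector \<open>\<Gamma>(v, u)\<close> into one slot,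
  and the induction hypothesis shows that this kills the previous tensor. What remains is the
  coordinate derivative, which prepends \<open>v\<close> to the list of \<open>G\<close>.
\<close>

lemma nabla_curv13_eq:
  assumes "length vs = n"
  shows "nabla_curv13 n (pp_metric F) P (vs @ [a, b, c]) = curv_apply (curv_form P vs a b) c"
  using assms
proof (induction n arbitrary: P vs a b c)
  case 0
  then show ?case by (simp add: nabla_curv13_def curv13_eq)
next
  case (Suc n)
  then obtain v ws where vs: "vs = v # ws" and ws: "length ws = n" by (auto simp: length_Suc_conv)
  define us where "us = ws @ [a, b, c]"
  have kill: "nabla_curv13 n (pp_metric F) P (us[j := \<beta>]) = 0"
    if \<beta>: "xc \<beta> = 0" "wc \<beta> = 0" and j: "j < length us" for j \<beta>
  proof -
    obtain ws' a' b' c' where us': "us[j := \<beta>] = ws' @ [a', b', c']" "length ws' = n"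
      by (rule split_off_three[of "us[j := \<beta>]" n]) (use ws in \<open>simp_all add: us_def\<close>)
    have "\<beta> \<in> set (us[j := \<beta>])" using j by (rule set_update_memI)
    then have "\<beta> \<in> set ws' \<or> \<beta> = a' \<or> \<beta> = b' \<or> \<beta> = c'" using us' by auto
    then have "curv_form P ws' a' b' = 0 \<or> \<beta> = c'" using curv_form_eq_0[OF \<beta>] by blast
    then have "curv_apply (curv_form P ws' a' b') c' = 0"
      using \<beta> by (simp only: point_eq_iff) (auto simp: curv_apply_def)
    then show ?thesis using Suc.IH us' by simp
  qed
  have bar: "xc (christoffel P v u) = 0" "wc (christoffel P v u) = 0" for u
    by (simp_all add: christoffel_def)
  have "nabla_curv13 (Suc n) (pp_metric F) P (vs @ [a, b, c]) =
      nabla (pp_metric F) (\<lambda>_. v) (\<lambda>Q. curv_apply (curv_form Q ws a b) c) P"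
    using kill[OF bar] Suc.IH[OF ws]
    by (simp add: nabla_curv13_def vs us_def nabla_const)
  also have "\<dots> = curv_apply (curv_form P (v # ws) a b) c"
    by (rule nabla_barred) (auto intro!: derivative_eq_intros simp: curv_apply_def)
  finally show ?case by (simp add: vs)
qed

definition curv_scalar ::
  "'m point \<Rightarrow> 'm point list \<Rightarrow> 'm point \<Rightarrow> 'm point \<Rightarrow> 'm point \<Rightarrow> 'm point \<Rightarrow> real" where
  "curv_scalar P vs a b c d =
     xc c * (curv_form P vs a b \<bullet> wc d) - xc d * (curv_form P vs a b \<bullet> wc c)"

text \<open>
  The argument is the same for the fully covariant tensor; the metric contributes nothing to the
  derivative since it pairs barred values with constant coefficients.
\<close>

lemma nabla_curv04_eq:
  assumes "length vs = n"
  shows "nabla_curv04 n (pp_metric F) P (vs @ [a, b, c, d]) = curv_scalar P vs a b c d"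
  using assms
proof (induction n arbitrary: P vs a b c d)
  case 0
  have "curv13 (pp_metric F) P [a, b, c, d] = curv13 (pp_metric F) P [a, b, c]"
    by (simp add: curv13_def)
  then have "curv04 (pp_metric F) P [a, b, c, d] = pp_metric F P (curv_apply (curv_form P [] a b) c) d"
    by (simp add: curv04_def curv13_eq)
  also have "\<dots> = curv_scalar P [] a b c d"
    by (simp add: curv_scalar_def curv_apply_def pp_metric_def)
  finally show ?case using 0 by (simp add: nabla_curv04_def)
next
  case (Suc n)
  then obtain v ws where vs: "vs = v # ws" and ws: "length ws = n" by (auto simp: length_Suc_conv)
  define us where "us = ws @ [a, b, c, d]"
  have kill: "nabla_curv04 n (pp_metric F) P (us[j := \<beta>]) = 0"
    if \<beta>: "xc \<beta> = 0" "wc \<beta> = 0" and j: "j < length us" for j \<beta>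
  proof -
    obtain ws' a' b' c' d' where us': "us[j := \<beta>] = ws' @ [a', b', c', d']" "length ws' = n"
      by (rule split_off_four[of "us[j := \<beta>]" n]) (use ws in \<open>simp_all add: us_def\<close>)
    have "\<beta> \<in> set (us[j := \<beta>])" using j by (rule set_update_memI)
    then have "\<beta> \<in> set ws' \<or> \<beta> = a' \<or> \<beta> = b' \<or> \<beta> = c' \<or> \<beta> = d'" using us' by auto
    then have "curv_form P ws' a' b' = 0 \<or> \<beta> = c' \<or> \<beta> = d'" using curv_form_eq_0[OF \<beta>] by blast
    then have "curv_scalar P ws' a' b' c' d' = 0"
      using \<beta> by (auto simp: curv_scalar_def)
    then show ?thesis using Suc.IH us' by simp
  qed
  have bar: "xc (christoffel P v u) = 0" "wc (christoffel P v u) = 0" for u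
    by (simp_all add: christoffel_def)
  have "((\<lambda>Q. curv_scalar Q ws a b c d) has_derivative (\<lambda>v. curv_scalar P (v # ws) a b c d)) (at P)"
    unfolding curv_scalar_def by (rule derivative_eq_intros refl | simp)+
  from frechet_derivative_at[OF this]
  have "frechet_derivative (\<lambda>Q. curv_scalar Q ws a b c d) (at P) v = curv_scalar P (v # ws) a b c d"
    by metis
  then show ?case
    using kill[OF bar] Suc.IH[OF ws] by (simp add: nabla_curv04_def vs us_def nabla_const)
qed

end

section \<open>Isometries and curvature models from changes of variables\<close>

text \<open>
  If \<open>wc\<close> is transformed by \<open>A\<close>, then \<open>wb\<close> has to be transformed by the inverse of the adjoint of \<open>A\<close>
  for the pairing \<open>dw dw'\<close> to survive. The relation is symmetric, which makes it more convenient
  than a function \<open>A \<mapsto> B\<close>.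
\<close>

definition dual_pair :: "('a::euclidean_space \<Rightarrow> 'a) \<Rightarrow> ('a \<Rightarrow> 'a) \<Rightarrow> bool" where
  "dual_pair A B \<longleftrightarrow> linear A \<and> linear B \<and> (\<forall>a b. A a \<bullet> B b = a \<bullet> b)"

lemma dual_pair_commute: "dual_pair A B \<Longrightarrow> dual_pair B A"
  unfolding dual_pair_def by (metis inner_commute)

lemma dual_pair_bij: assumes "dual_pair A B" shows "bij A"
proof -
  have "a = 0" if "A a = 0" for a
    using assms that unfolding dual_pair_def by (metis inner_eq_zero_iff inner_zero_left)
  then have "inj A" using assms linear_injective_0 unfolding dual_pair_def by blast
  then show ?thesis
    using assms linear_injective_imp_surjective unfolding dual_pair_def bij_def by blast
qed

lemma dual_pair_exists:
  fixes A :: "'a::euclidean_space \<Rightarrow> 'a"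
  assumes "linear A" "inj A"
  shows "\<exists>B. dual_pair A B"
proof -
  have "bij A" using assms linear_injective_imp_surjective bij_def by blast
  then have "A a \<bullet> adjoint (inv A) b = a \<bullet> b" for a b
    using assms by (simp add: adjoint_works inj_linear_imp_inv_linear bij_is_inj)
  then have "dual_pair A (adjoint (inv A))"
    unfolding dual_pair_def using assms \<open>bij A\<close> by (simp add: inj_linear_imp_inv_linear adjoint_linear)
  then show ?thesis by (intro exI[of _ "adjoint (inv A)"])
qed

lemma polynomial_function_bounded_linear_o:
  fixes h :: "'a::real_normed_vector \<Rightarrow> 'b::real_normed_vector" and L :: "'b \<Rightarrow> 'c::real_normed_vector"
  assumes "bounded_linear L" "polynomial_function h"
  shows "polynomial_function (\<lambda>P. L (h P))"
  unfolding polynomial_function_def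
proof (intro allI impI)
  fix f :: "'c \<Rightarrow> real" assume "bounded_linear f"
  then have "bounded_linear (\<lambda>v. f (L v))" using assms(1) by (rule bounded_linear_compose)
  then have "real_polynomial_function ((\<lambda>v. f (L v)) \<circ> h)"
    using assms(2)[unfolded polynomial_function_def, rule_format] by (simp only:)
  then show "real_polynomial_function (f \<circ> (\<lambda>P. L (h P)))" by (simp only: o_def)
qed

lemma polynomial_function_mk_pt:
  assumes "polynomial_function a" "polynomial_function b" "polynomial_function c" "polynomial_function d"
  shows "polynomial_function (\<lambda>P. mk_pt (a P) (b P) (c P) (d P))"
proof -
  have bl: "bounded_linear (\<lambda>r. mk_pt r 0 0 0)" "bounded_linear (\<lambda>w. mk_pt 0 w 0 0)"
    "bounded_linear (\<lambda>r. mk_pt 0 0 r 0)" "bounded_linear (\<lambda>w. mk_pt 0 0 0 w)"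
    by (intro linear_conv_bounded_linear[THEN iffD1] linearI;
        simp only: point_eq_iff; simp)+
  have "mk_pt (a P) (b P) (c P) (d P) =
      mk_pt (a P) 0 0 0 + mk_pt 0 (b P) 0 0 + mk_pt 0 0 (c P) 0 + mk_pt 0 0 0 (d P)" for P
    by (simp only: point_eq_iff) simp
  then show ?thesis
    by (simp only:) (intro polynomial_function_add bl[THEN polynomial_function_bounded_linear_o] assms)
qed

text \<open>
  The barred components absorb the affine discrepancy \<open>\<alpha> \<bullet> w + \<beta>\<close> of the potentials: the term
  \<open>- x\<^sup>2/2 \<alpha>\<close> added to \<open>w'\<close> contributes \<open>- 2 x (\<alpha> \<bullet> dw) dx\<close>, while \<open>x (\<alpha> \<bullet> w) + \<beta> x\<close> added to \<open>x'\<close>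
  contributes \<open>2 (\<alpha> \<bullet> w + \<beta>) dx\<^sup>2 + 2 x (\<alpha> \<bullet> dw) dx\<close>; the mixed terms cancel. The constants \<open>a\<close>, \<open>a'\<close>,
  \<open>b'\<close> are free translations.
\<close>

lemma is_isometry_pp_metric:
  fixes A B :: "'m::finite base \<Rightarrow> 'm base"
  assumes lam: "lam \<noteq> 0" and AB: "dual_pair A B"
    and F: "\<And>w. lam\<^sup>2 * F (A w + b) = F w + \<alpha> \<bullet> w + \<beta>"
  shows "is_isometry (pp_metric F) (\<lambda>P. mk_pt (lam * xc P + a) (A (wc P) + b)
      ((xb P + xc P * (\<alpha> \<bullet> wc P) + \<beta> * xc P) / lam + a') (B (wb P - ((xc P)\<^sup>2 / 2) *\<^sub>R \<alpha>) + b'))"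
    (is "is_isometry _ ?\<phi>")
proof -
  have bij: "bij A" "bij B" using AB dual_pair_bij dual_pair_commute by blast+
  have lin: "linear A" "linear B" "linear (inv A)" "linear (inv B)"
    using AB bij inj_linear_imp_inv_linear bij_is_inj unfolding dual_pair_def by blast+
  have AB_inner: "A u \<bullet> B v = u \<bullet> v" "B v \<bullet> A u = u \<bullet> v" for u v
    using AB unfolding dual_pair_def by (metis inner_commute)+
  define \<psi> :: "'m point \<Rightarrow> 'm point" where "\<psi> P = (let x = (xc P - a) / lam; w = inv A (wc P - b) in
    mk_pt x w (lam * (xb P - a') - x * (\<alpha> \<bullet> w) - \<beta> * x) (inv B (wb P - b') + (x\<^sup>2 / 2) *\<^sub>R \<alpha>))" for P
  have \<psi>\<phi>: "\<psi> (?\<phi> P) = P" for P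
    unfolding \<psi>_def Let_def using lam bij
    by (simp only: point_eq_iff) (simp add: bij_is_inj)
  have \<phi>\<psi>: "?\<phi> (\<psi> P) = P" for P
    unfolding \<psi>_def Let_def using lam bij
    by (simp only: point_eq_iff) (simp add: bij_is_surj surj_f_inv_f)
  have "bij ?\<phi>" by (rule bij_betw_byWitness[where f' = \<psi>]) (use \<psi>\<phi> \<phi>\<psi> in auto)
  moreover have "inv ?\<phi> = \<psi>" by (rule inv_equality) (use \<psi>\<phi> \<phi>\<psi> in auto)
  moreover have coord: "polynomial_function xc" "polynomial_function wc" "polynomial_function xb"
    "polynomial_function wb"
    by (intro polynomial_function_bounded_linear bounded_linear_coord)+
  note lin[unfolded linear_conv_bounded_linear, THEN polynomial_function_bounded_linear_o]
  note poly = this coord polynomial_function_mk_pt polynomial_function_add polynomial_function_diff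
    polynomial_function_const polynomial_function_mult polynomial_function_mult[where 'b=real, simplified]
    polynomial_function_bounded_linear_o[OF bounded_linear_inner_right]
    polynomial_function_bounded_linear_o[OF bounded_linear_divide]
  have "smooth ?\<phi>"
    unfolding power2_eq_square by (intro smooth_polynomial_function poly)
  moreover have "smooth \<psi>"
    unfolding \<psi>_def Let_def power2_eq_square by (intro smooth_polynomial_function poly)
  moreover have "pp_metric F (?\<phi> P) (frechet_derivative ?\<phi> (at P) u) (frechet_derivative ?\<phi> (at P) v)
      = pp_metric F P u v" for P u v
  proof -
    note [derivative_intros] = lin[THEN linear_imp_has_derivative, THEN has_derivative_compose[rotated]]
    have "(?\<phi> has_derivative (\<lambda>u. mk_pt (lam * xc u) (A (wc u))
        ((xb u + xc u * (\<alpha> \<bullet> wc P) + xc P * (\<alpha> \<bullet> wc u) + \<beta> * xc u) / lam)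
        (B (wb u - (xc P * xc u) *\<^sub>R \<alpha>)))) (at P)"
      unfolding divide_inverse by (auto intro!: derivative_eq_intros ext simp: algebra_simps)
    from frechet_derivative_at[OF this, symmetric]
    have d: "frechet_derivative ?\<phi> (at P) u = mk_pt (lam * xc u) (A (wc u))
        ((xb u + xc u * (\<alpha> \<bullet> wc P) + xc P * (\<alpha> \<bullet> wc u) + \<beta> * xc u) / lam)
        (B (wb u - (xc P * xc u) *\<^sub>R \<alpha>))" for u
      by metis
    have c: "lam * r * (s / lam) = r * s" "(s / lam) * (lam * r) = s * r" for r s
      using lam by simp_all
    have f: "2 * F (A (wc P) + b) * (lam * xc u) * (lam * xc v) =
        2 * (F (wc P) + \<alpha> \<bullet> wc P + \<beta>) * xc u * xc v"
      using F[of "wc P", symmetric] by (simp add: power2_eq_square)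
    show ?thesis
      unfolding d pp_metric_def coord_mk_pt AB_inner c f
      by (simp add: inner_diff_left inner_diff_right algebra_simps inner_commute[of \<alpha>]
          inner_commute[of "wc v" "wb u"])
  qed
  ultimately show ?thesis unfolding is_isometry_def by simp
qed

text \<open>
  Infinitesimally, the values of the potentials at the two points need not correspond under the
  change of variables: their discrepancy only affects \<open>g(\<partial>\<^sub>x, \<partial>\<^sub>x)\<close> and is corrected by a multiple \<open>\<kappa>\<close> of
  \<open>xc\<close> in the \<open>xb\<close> component. The first derivatives do not enter the curvature, hence the lower bound
  on the length of \<open>ws\<close>.
\<close>

lemma linear_model:
  fixes A B :: "'m::finite base \<Rightarrow> 'm base"
  assumes "derivative_tower F G" "derivative_tower F' G'" and lam: "lam \<noteq> 0" and AB: "dual_pair A B"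
    and jets: "\<And>ws t. 1 \<le> length ws \<Longrightarrow> length ws \<le> k + 1 \<Longrightarrow>
        lam\<^sup>2 * (G' (wc Q) (map A ws) \<bullet> A t) = G (wc P) ws \<bullet> t"
  shows "\<exists>\<phi>. linear \<phi> \<and> bij \<phi> \<and> (\<forall>u v. pp_metric F' Q (\<phi> u) (\<phi> v) = pp_metric F P u v) \<and>
      (\<forall>i\<le>k. \<forall>us. length us = i + 4 \<longrightarrow>
        nabla_curv04 i (pp_metric F') Q (map \<phi> us) = nabla_curv04 i (pp_metric F) P us)"
proof -
  interpret M: derivative_tower F G by fact
  interpret N: derivative_tower F' G' by fact
  have lin: "linear A" "linear B" using AB unfolding dual_pair_def by blast+
  have AB_inner: "A u \<bullet> B v = u \<bullet> v" "B v \<bullet> A u = u \<bullet> v" for u v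
    using AB unfolding dual_pair_def by (metis inner_commute)+
  define \<kappa> where "\<kappa> = (lam\<^sup>2 * F' (wc Q) - F (wc P)) / lam"
  define \<phi> where "\<phi> u = mk_pt (lam * xc u) (A (wc u)) (xb u / lam + \<kappa> * xc u) (B (wb u))" for u
  have "linear \<phi>"
    by (rule linearI; simp only: point_eq_iff)
      (simp_all add: \<phi>_def lin[THEN linear_add] lin[THEN linear_cmul] algebra_simps add_divide_distrib)
  have metric: "pp_metric F' Q (\<phi> u) (\<phi> v) = pp_metric F P u v" for u v
    using lam by (simp add: pp_metric_def \<phi>_def \<kappa>_def AB_inner field_simps power2_eq_square inner_commute)
  have "u = 0" if "\<phi> u = 0" for u
  proof (rule pp_metric_nondegenerate)
    show "pp_metric F P u t = pp_metric F P 0 t" for t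
      using metric[of u t] metric[of 0 t] that linear_0[OF \<open>linear \<phi>\<close>] by simp
  qed
  then have "bij \<phi>"
    using \<open>linear \<phi>\<close> linear_injective_0 linear_injective_imp_surjective unfolding bij_def by blast
  have "nabla_curv04 i (pp_metric F') Q (map \<phi> us) = nabla_curv04 i (pp_metric F) P us"
    if "i \<le> k" "length us = i + 4" for i us
  proof -
    obtain vs a b c d where us: "us = vs @ [a, b, c, d]" and vs: "length vs = i"
      using \<open>length us = i + 4\<close> by (rule split_off_four)
    have *: "lam\<^sup>2 * (G' (wc Q) (map (wc \<circ> \<phi>) vs @ [A (wc a)]) \<bullet> A t) =
        G (wc P) (map wc vs @ [wc a]) \<bullet> t" for a t
    proof -
      have m: "map (wc \<circ> \<phi>) vs @ [A (wc a)] = map A (map wc vs @ [wc a])" by (simp add: \<phi>_def)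
      show ?thesis unfolding m using that vs by (intro jets) simp_all
    qed
    have form: "lam * (N.curv_form Q (map \<phi> vs) (\<phi> a) (\<phi> b) \<bullet> A t) = M.curv_form P vs a b \<bullet> t" for t
      unfolding M.curv_form_def inner_diff_left inner_scaleR_left *[symmetric]
      by (simp add: N.curv_form_def \<phi>_def inner_diff_left power2_eq_square algebra_simps)
    have "N.curv_scalar Q (map \<phi> vs) (\<phi> a) (\<phi> b) (\<phi> c) (\<phi> d) =
        xc c * (lam * (N.curv_form Q (map \<phi> vs) (\<phi> a) (\<phi> b) \<bullet> A (wc d)))
        - xc d * (lam * (N.curv_form Q (map \<phi> vs) (\<phi> a) (\<phi> b) \<bullet> A (wc c)))"
      by (simp add: N.curv_scalar_def) (simp add: \<phi>_def algebra_simps)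
    then have "N.curv_scalar Q (map \<phi> vs) (\<phi> a) (\<phi> b) (\<phi> c) (\<phi> d) = M.curv_scalar P vs a b c d"
      unfolding form M.curv_scalar_def .
    then show ?thesis
      using N.nabla_curv04_eq[of "map \<phi> vs" i] M.nabla_curv04_eq[of vs i] vs us by simp
  qed
  then show ?thesis using \<open>linear \<phi>\<close> \<open>bij \<phi>\<close> metric by blast
qed

section \<open>Derivatives of the polynomial part of the potential\<close>

text \<open>
  A function whose derivatives of high order vanish identically and whose lower derivatives, itself
  included, vanish at one point is zero: each derivative in turn is constant. This replaces Taylor
  expansion in what follows.
\<close>

lemma vanishing_by_derivatives:
  fixes h :: "nat \<Rightarrow> real \<Rightarrow> real"
  assumes deriv: "\<And>n t. (h n has_real_derivative h (Suc n) t) (at t)"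
    and top: "\<And>t. h N t = 0" and base: "\<And>n. m \<le> n \<Longrightarrow> n < N \<Longrightarrow> h n a = 0" and "m \<le> N"
  shows "h m t = 0"
  using \<open>m \<le> N\<close> base
proof (induction arbitrary: t rule: inc_induct)
  case base
  show ?case by (rule top)
next
  case (step n)
  have "(h n has_real_derivative 0) (at t)" for t
    using deriv[of n t] step by simp
  then have "h n t = h n a" by (metis DERIV_isconst_all)
  also have "\<dots> = 0" using step by simp
  finally show ?case .
qed

text \<open>
  \<open>qvec p e n\<close> is the \<open>n\<close>-th derivative of the curve \<open>y \<mapsto> (y, y\<^sup>2, \<dots>, y\<^sup>p\<^sup>+\<^sup>1)\<close>, the coordinates being
  enumerated by \<open>e\<close>. The truncated subtractions are harmless: for \<open>n > i + 1\<close> the falling factorial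
  \<open>qcoeff n i\<close> contains the factor zero.
\<close>

definition qcoeff :: "nat \<Rightarrow> nat \<Rightarrow> real" where "qcoeff n i = (\<Prod>j<n. real (Suc i - j))"

definition qvec :: "nat \<Rightarrow> (nat \<Rightarrow> 'm::finite) \<Rightarrow> nat \<Rightarrow> real \<Rightarrow> real ^ 'm" where
  "qvec p e n y = (\<Sum>i\<le>p. (qcoeff n i * y ^ (Suc i - n)) *\<^sub>R axis (e i) 1)"

lemma qvec_has_vector_derivative: "(qvec p e n has_vector_derivative qvec p e (Suc n) y) (at y)"
  unfolding qvec_def
proof (rule has_vector_derivative_sum)
  fix i
  have "((\<lambda>y. qcoeff n i * y ^ (Suc i - n)) has_real_derivative
      qcoeff (Suc n) i * y ^ (Suc i - Suc n)) (at y)"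
    by (rule derivative_eq_intros refl | simp add: qcoeff_def)+
  then have "((\<lambda>y. qcoeff n i * y ^ (Suc i - n)) has_vector_derivative
      qcoeff (Suc n) i * y ^ (Suc i - Suc n)) (at y)"
    by (simp add: has_real_derivative_iff_has_vector_derivative)
  from bounded_linear.has_vector_derivative[OF bounded_linear_scaleR_left this]
  show "((\<lambda>y. (qcoeff n i * y ^ (Suc i - n)) *\<^sub>R axis (e i) 1) has_vector_derivative
      (qcoeff (Suc n) i * y ^ (Suc i - Suc n)) *\<^sub>R axis (e i) 1) (at y)" .
qed

lemma qvec_eq_0: "p + 2 \<le> n \<Longrightarrow> qvec p e n y = 0"
  unfolding qvec_def
proof (rule sum.neutral, rule ballI)
  fix i assume "p + 2 \<le> n" "i \<in> {..p}"
  then have "qcoeff n i = 0" unfolding qcoeff_def by (intro prod_zero bexI[of _ "Suc i"]) auto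
  then show "(qcoeff n i * y ^ (Suc i - n)) *\<^sub>R axis (e i) (1::real) = (0 :: real ^ _)" by simp
qed

lemma qvec_0_inner: "qvec p e 0 y \<bullet> z = (\<Sum>i\<le>p. y ^ (i + 1) * (z $ e i))"
  by (simp add: qvec_def qcoeff_def inner_sum_left inner_axis')

lemma qvec_inner_has_derivative:
  "((\<lambda>y. qvec p e n y \<bullet> z) has_real_derivative qvec p e (Suc n) y \<bullet> z) (at y)"
  using bounded_linear.has_vector_derivative[OF bounded_linear_inner_left qvec_has_vector_derivative]
  by (simp add: has_real_derivative_iff_has_vector_derivative)

lemma qvec_at_0_inner:
  assumes "k \<le> p"
  shows "qvec p e (Suc k) 0 \<bullet> z = qcoeff (Suc k) k * (z $ e k)"
proof -
  have "qcoeff (Suc k) i * 0 ^ (Suc i - Suc k) * (z $ e i) =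
      (if i = k then qcoeff (Suc k) k * (z $ e k) else 0)" for i
    by (auto simp: qcoeff_def)
  then show ?thesis
    using assms by (simp add: qvec_def inner_sum_left inner_axis')
qed

lemma qcoeff_pos: "qcoeff (Suc k) k > 0"
  by (auto simp: qcoeff_def intro!: prod_pos)

text \<open>
  If all derivatives of \<open>q(y) \<bullet> z\<close> of positive order vanish at one \<open>y\<close>, then they vanish everywhere,
  and at \<open>0\<close> the derivative of order \<open>k + 1\<close> isolates the coordinate \<open>z $ e k\<close>.
\<close>

lemma qvec_inner_injective:
  assumes "bij_betw e {..p} UNIV" and "\<And>n. 1 \<le> n \<Longrightarrow> n \<le> p + 1 \<Longrightarrow> qvec p e n y \<bullet> z = 0"
  shows "z = 0"
proof -
  have "qvec p e (Suc k) 0 \<bullet> z = 0" if "k \<le> p" for k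
  proof (rule vanishing_by_derivatives[where N = "p + 2" and a = y and m = "Suc k" and t = 0
        and h = "\<lambda>n y. qvec p e n y \<bullet> z"])
    show "qvec p e n y \<bullet> z = 0" if "Suc k \<le> n" "n < p + 2" for n
      using that by (intro assms(2)) simp_all
  qed (use that in \<open>simp_all add: qvec_inner_has_derivative qvec_eq_0\<close>)
  then have "z $ e k = 0" if "k \<le> p" for k
    using that by (metis qvec_at_0_inner mult_eq_0_iff order_less_irrefl qcoeff_pos)
  moreover have "\<exists>k\<le>p. i = e k" for i
    using bij_betw_imp_surj_on[OF assms(1)] by (metis atMost_iff imageE iso_tuple_UNIV_I)
  ultimately show ?thesis by (metis vec_eq_iff zero_index)
qed

text \<open>
  There are as many conditions as coordinates, so injectivity gives a linear map that realises
  prescribed derivatives of order \<open>1, \<dots>, p + 1\<close> at \<open>y\<close>.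
\<close>

lemma qvec_inner_interpolation:
  fixes e :: "nat \<Rightarrow> 'm::finite"
  assumes "bij_betw e {..p} UNIV"
  shows "\<exists>S. linear S \<and> (\<forall>w n. 1 \<le> n \<longrightarrow> n \<le> p + 1 \<longrightarrow> qvec p e n y \<bullet> S w = w $ e (n - 1))"
proof -
  define E :: "real ^ 'm \<Rightarrow> real ^ 'm" where
    "E z = (\<Sum>i\<le>p. (qvec p e (Suc i) y \<bullet> z) *\<^sub>R axis (e i) 1)" for z
  have lin: "linear E"
    by (rule linearI)
      (simp_all add: E_def inner_add_right scaleR_add_left sum.distrib scaleR_sum_right)
  have comp: "E z $ e k = qvec p e (Suc k) y \<bullet> z" if "k \<le> p" for k z
  proof -
    have "e k = e i \<longleftrightarrow> i = k" if "i \<le> p" for i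
      using inj_on_eq_iff[OF bij_betw_imp_inj_on[OF assms], of k i] that \<open>k \<le> p\<close> by auto
    then have "E z $ e k = (\<Sum>i\<le>p. if i = k then qvec p e (Suc k) y \<bullet> z else 0)"
      unfolding E_def sum_component by (intro sum.cong) (auto simp: axis_def)
    then show ?thesis using that by simp
  qed
  have "z = 0" if "E z = 0" for z
  proof (rule qvec_inner_injective[OF assms])
    fix n assume "1 \<le> n" "n \<le> p + 1"
    then show "qvec p e n y \<bullet> z = 0" using comp[of "n - 1" z] that by simp
  qed
  then have "inj E" using lin linear_injective_0 by blast
  then have "surj E" using lin linear_injective_imp_surjective by blast
  then obtain S where S: "linear S" "E \<circ> S = id"
    using lin linear_surjective_right_inverse by blast
  have "qvec p e n y \<bullet> S w = w $ e (n - 1)" if "1 \<le> n" "n \<le> p + 1" for w n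
  proof -
    have "E (S w) = w" using S(2) by (metis comp_apply id_apply)
    then show ?thesis using comp[of "n - 1" "S w"] that by simp
  qed
  then show ?thesis using S(1) by blast
qed

section \<open>Derivatives of the potential\<close>

text \<open>
  The potential is linear in \<open>z\<close>, so \<open>D\<^sup>k\<^sup>+\<^sup>1\<close> of \<open>q(y) \<bullet> z\<close> in \<open>k + 1\<close> directions has two parts: all
  directions act on \<open>y\<close>, or exactly one of them acts on \<open>z\<close> and the others on \<open>y\<close>. The sum below
  over the direction acting on \<open>z\<close> is the second part, with \<open>k\<close> the number of \<open>y\<close>-derivatives. The
  number \<open>k\<close> is a separate argument since differentiation along \<open>y\<close> raises it and leaves the list
  alone.
\<close>

primrec cross_terms :: "nat \<Rightarrow> (nat \<Rightarrow> 'm::finite) \<Rightarrow> nat \<Rightarrow> real \<Rightarrow> 'm base list \<Rightarrow> real" where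
  "cross_terms p e k y [] = 0"
| "cross_terms p e k y (w # ws) =
     (qvec p e k y \<bullet> snd w) * prod_list (map fst ws) + fst w * cross_terms p e k y ws"

text \<open>
  The gradient tower of the potential, where \<open>fd n\<close> is the \<open>n\<close>-th derivative of \<open>f\<close>. The two
  components are the derivatives along \<open>y\<close> and along \<open>z\<close> of \<open>D\<^sup>n F\<close> in the directions \<open>ws\<close>.
\<close>

definition jet :: "nat \<Rightarrow> (nat \<Rightarrow> 'm::finite) \<Rightarrow> (nat \<Rightarrow> real \<Rightarrow> real) \<Rightarrow> 'm base \<Rightarrow> 'm base list \<Rightarrow> 'm base" where
  "jet p e fd w ws = (let n = length ws; y = fst w in
     ((fd (Suc n) y + qvec p e (Suc n) y \<bullet> snd w) * prod_list (map fst ws) + cross_terms p e n y ws,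
      prod_list (map fst ws) *\<^sub>R qvec p e n y))"

abbreviation pot :: "nat \<Rightarrow> (nat \<Rightarrow> 'm::finite) \<Rightarrow> (real \<Rightarrow> real) \<Rightarrow> 'm base \<Rightarrow> real" where
  "pot p e f \<equiv> \<lambda>w. F_pot p e f (fst w) (snd w)"

lemma pot_eq: "pot p e f w = f (fst w) + qvec p e 0 (fst w) \<bullet> snd w"
  by (simp add: F_pot_def qvec_0_inner)

lemma cross_terms_zero: "0 \<in> set ws \<Longrightarrow> cross_terms p e k y ws = 0 \<and> prod_list (map fst ws) = 0"
  by (induction ws) auto

lemma cross_terms_has_derivative:
  "((\<lambda>y. cross_terms p e k y ws) has_real_derivative cross_terms p e (Suc k) y ws) (at y)"
proof (induction ws)
  case (Cons w ws)
  then show ?case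
    using qvec_inner_has_derivative[of p e k "snd w" y] by (auto intro!: derivative_eq_intros)
qed simp

lemma fst_comp_has_derivative:
  assumes "(h has_real_derivative h') (at (fst (w::'m::finite base)))"
  shows "((\<lambda>w. h (fst w)) has_derivative (\<lambda>v. h' * fst v)) (at w)"
  using has_derivative_compose[OF has_derivative_fst[OF has_derivative_ident]
      assms[unfolded has_field_derivative_def]] by simp

lemma qvec_snd_has_derivative:
  "((\<lambda>w. qvec p e n (fst w) \<bullet> snd w) has_derivative
     (\<lambda>v. (qvec p e (Suc n) (fst w) \<bullet> snd w) * fst v + qvec p e n (fst w) \<bullet> snd v)) (at w)"
proof -
  have "((\<lambda>w. qvec p e n (fst w)) has_derivative (\<lambda>v. fst v *\<^sub>R qvec p e (Suc n) (fst w))) (at w)"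
    using has_derivative_compose[OF has_derivative_fst[OF has_derivative_ident]
      qvec_has_vector_derivative[unfolded has_vector_derivative_def]] .
  from has_derivative_inner[OF this has_derivative_snd[OF has_derivative_ident]]
  show ?thesis by (rule has_derivative_eq_rhs) (auto simp: fun_eq_iff)
qed

lemma derivative_tower_jet:
  fixes e :: "nat \<Rightarrow> 'm::finite"
  assumes fd: "\<And>n y. (fd n has_real_derivative fd (Suc n) y) (at y)"
  shows "derivative_tower (pot p e (fd 0)) (jet p e fd)"
proof
  fix w :: "'m base"
  have "((\<lambda>w. fd 0 (fst w) + qvec p e 0 (fst w) \<bullet> snd w) has_derivative
      (\<lambda>v. fd 1 (fst w) * fst v
        + ((qvec p e (Suc 0) (fst w) \<bullet> snd w) * fst v + qvec p e 0 (fst w) \<bullet> snd v))) (at w)"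
    using fd[of 0] by (intro has_derivative_add fst_comp_has_derivative qvec_snd_has_derivative) simp
  moreover have "(\<lambda>v. fd 1 (fst w) * fst v
      + ((qvec p e (Suc 0) (fst w) \<bullet> snd w) * fst v + qvec p e 0 (fst w) \<bullet> snd v))
      = (\<lambda>v. jet p e fd w [] \<bullet> v)"
    by (simp add: jet_def Let_def inner_prod_def fun_eq_iff algebra_simps)
  ultimately show "(pot p e (fd 0) has_derivative (\<lambda>v. jet p e fd w [] \<bullet> v)) (at w)"
    unfolding pot_eq by simp
next
  fix w :: "'m base" and ws :: "'m base list"
  let ?n = "length ws" and ?\<Pi> = "prod_list (map fst ws)" and ?y = "fst w"
  have "((\<lambda>w. ((fd (Suc ?n) (fst w) + qvec p e (Suc ?n) (fst w) \<bullet> snd w) * ?\<Pi>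
           + cross_terms p e ?n (fst w) ws, ?\<Pi> *\<^sub>R qvec p e ?n (fst w))) has_derivative
     (\<lambda>v. ((fd (Suc (Suc ?n)) ?y * fst v
             + ((qvec p e (Suc (Suc ?n)) ?y \<bullet> snd w) * fst v + qvec p e (Suc ?n) ?y \<bullet> snd v)) * ?\<Pi>
           + cross_terms p e (Suc ?n) ?y ws * fst v, ?\<Pi> *\<^sub>R (fst v *\<^sub>R qvec p e (Suc ?n) ?y)))) (at w)"
    by (intro has_derivative_Pair has_derivative_add has_derivative_mult_left has_derivative_scaleR_right
        fst_comp_has_derivative qvec_snd_has_derivative fd cross_terms_has_derivative
        has_derivative_compose[OF has_derivative_fst[OF has_derivative_ident]
          qvec_has_vector_derivative[unfolded has_vector_derivative_def]])
  then show "((\<lambda>w. jet p e fd w ws) has_derivative (\<lambda>v. jet p e fd w (v # ws))) (at w)"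
    by (simp add: jet_def Let_def algebra_simps)
next
  fix w a b :: "'m base"
  show "jet p e fd w [a] \<bullet> b = jet p e fd w [b] \<bullet> a"
    by (simp add: jet_def Let_def inner_prod_def algebra_simps)
next
  fix w :: "'m base" and ws assume "(0::'m base) \<in> set ws"
  then show "jet p e fd w ws = 0"
    by (simp add: jet_def cross_terms_zero zero_prod_def)
qed

section \<open>Matching the derivatives at two points\<close>

lemma cross_terms_map:
  fixes e :: "nat \<Rightarrow> 'm::finite"
  assumes "\<And>\<zeta>. r * (qvec p e k y' \<bullet> L \<zeta>) = qvec p e k y \<bullet> \<zeta>"
  shows "r * \<mu> * cross_terms p e k y' (map (\<lambda>w. (\<mu> * fst w, L (snd w) + fst w *\<^sub>R c)) ws) =
    \<mu> ^ length ws * (cross_terms p e k y ws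
      + length ws * (r * (qvec p e k y' \<bullet> c)) * prod_list (map fst ws))"
proof (induction ws)
  case (Cons w ws)
  have "prod_list (map (\<lambda>w. \<mu> * fst w) ws) = \<mu> ^ length ws * prod_list (map fst ws)" for ws :: "'m base list"
    by (induction ws) simp_all
  then have "r * \<mu> * cross_terms p e k y' (map (\<lambda>w. (\<mu> * fst w, L (snd w) + fst w *\<^sub>R c)) (w # ws)) =
      \<mu> * (r * (qvec p e k y' \<bullet> L (snd w)) + fst w * (r * (qvec p e k y' \<bullet> c)))
        * (\<mu> ^ length ws * prod_list (map fst ws))
      + \<mu> * fst w * (r * \<mu> * cross_terms p e k y' (map (\<lambda>w. (\<mu> * fst w, L (snd w) + fst w *\<^sub>R c)) ws))"
    by (simp add: o_def inner_add_right algebra_simps)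
  then show ?case unfolding Cons assms by (simp add: algebra_simps)
qed simp

text \<open>
  Under \<open>A (t, \<zeta>) = (\<mu> t, L \<zeta> + t c)\<close> the derivative of order \<open>n + 1\<close> at \<open>w'\<close> becomes, up to the factor
  \<open>lam\<^sup>2\<close>, the one at \<open>w\<close>. Condition \<open>C1\<close> matches the terms with one \<open>z\<close>-direction. In the pure
  \<open>y\<close>-term each of the \<open>n + 1\<close> directions contributes the shear \<open>c\<close> once, which explains the factor
  \<open>Suc n\<close> in \<open>C2\<close>.
\<close>

lemma jet_map:
  fixes e :: "nat \<Rightarrow> 'm::finite"
  assumes \<mu>: "\<mu> \<noteq> 0" and n: "n = length ws"
    and C1: "\<And>\<zeta>. lam\<^sup>2 * \<mu> ^ n * (qvec p e n (fst w') \<bullet> L \<zeta>) = qvec p e n (fst w) \<bullet> \<zeta>"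
    and C2: "lam\<^sup>2 * \<mu> ^ n * ((fd' (Suc n) (fst w') + qvec p e (Suc n) (fst w') \<bullet> snd w') * \<mu>
        + real (Suc n) * (qvec p e n (fst w') \<bullet> c)) = fd (Suc n) (fst w) + qvec p e (Suc n) (fst w) \<bullet> snd w"
  shows "lam\<^sup>2 * (jet p e fd' w' (map (\<lambda>w. (\<mu> * fst w, L (snd w) + fst w *\<^sub>R c)) ws)
      \<bullet> (\<mu> * fst t, L (snd t) + fst t *\<^sub>R c)) = jet p e fd w ws \<bullet> t"
proof -
  let ?A = "\<lambda>w. (\<mu> * fst w, L (snd w) + fst w *\<^sub>R c)"
  define pr where "pr = prod_list (map fst ws)"
  define X where "X = cross_terms p e n (fst w') (map ?A ws)"
  define f' where "f' = fd' (Suc n) (fst w') + qvec p e (Suc n) (fst w') \<bullet> snd w'"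
  have prod: "prod_list (map (\<lambda>w. \<mu> * fst w) ws) = \<mu> ^ n * pr"
    unfolding n pr_def by (induction ws) simp_all
  have "lam\<^sup>2 * \<mu> ^ n * \<mu> * X = \<mu> ^ n * (cross_terms p e n (fst w) ws
      + n * (lam\<^sup>2 * \<mu> ^ n * (qvec p e n (fst w') \<bullet> c)) * pr)"
    unfolding X_def pr_def using cross_terms_map[where r = "lam\<^sup>2 * \<mu> ^ n", OF C1] n by simp
  then have "\<mu> ^ n * (lam\<^sup>2 * \<mu> * X) = \<mu> ^ n * (cross_terms p e n (fst w) ws
      + n * (lam\<^sup>2 * \<mu> ^ n * (qvec p e n (fst w') \<bullet> c)) * pr)"
    by (simp add: algebra_simps)
  then have X: "lam\<^sup>2 * \<mu> * X = cross_terms p e n (fst w) ws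
      + n * (lam\<^sup>2 * \<mu> ^ n * (qvec p e n (fst w') \<bullet> c)) * pr"
    using \<mu> by (simp only: mult_cancel_left power_eq_0_iff) simp
  have "lam\<^sup>2 * (jet p e fd' w' (map ?A ws) \<bullet> ?A t) =
      fst t * pr * (lam\<^sup>2 * \<mu> ^ n * (f' * \<mu> + qvec p e n (fst w') \<bullet> c))
      + fst t * (lam\<^sup>2 * \<mu> * X) + pr * (lam\<^sup>2 * \<mu> ^ n * (qvec p e n (fst w') \<bullet> L (snd t)))"
    by (simp add: jet_def Let_def o_def prod n[symmetric] X_def[symmetric] f'_def
        inner_add_right algebra_simps)
  also have "\<dots> = fst t * pr * (lam\<^sup>2 * \<mu> ^ n * (f' * \<mu> + real (Suc n) * (qvec p e n (fst w') \<bullet> c)))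
      + fst t * cross_terms p e n (fst w) ws + pr * (qvec p e n (fst w) \<bullet> snd t)"
    unfolding X C1 by (simp add: algebra_simps)
  also have "\<dots> = jet p e fd w ws \<bullet> t"
    unfolding C2[folded f'_def]
    by (cases t) (simp add: jet_def Let_def n[symmetric] pr_def[symmetric] algebra_simps)
  finally show ?thesis .
qed

text \<open>
  The map \<open>L\<close> and the vector \<open>c\<close> come from interpolating derivatives of order \<open>1, \<dots>, p + 1\<close> at
  \<open>y'\<close>. Since \<open>q\<^sup>(\<^sup>n\<^sup>) = 0\<close> from \<open>n = p + 2\<close> on, the condition on \<open>L\<close> then reads \<open>0 = 0\<close>, whereas \<open>c\<close> can
  no longer adjust anything: the functions \<open>f\<close> have to match there by scaling alone.
\<close>

lemma jet_transfer_exists: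
  fixes e :: "nat \<Rightarrow> 'm::finite" and h :: "nat \<Rightarrow> real"
  assumes e: "bij_betw e {..p} UNIV" and r: "\<And>n. r n \<noteq> 0"
  obtains L c where "linear L" "inj L"
    and "\<And>n \<zeta>. 1 \<le> n \<Longrightarrow> r n * (qvec p e n y' \<bullet> L \<zeta>) = qvec p e n y \<bullet> \<zeta>"
    and "\<And>n. 1 \<le> n \<Longrightarrow> n \<le> p + 1 \<Longrightarrow> qvec p e n y' \<bullet> c = h n"
proof -
  obtain S where S: "linear S" "\<And>w n. 1 \<le> n \<Longrightarrow> n \<le> p + 1 \<Longrightarrow> qvec p e n y' \<bullet> S w = w $ e (n - 1)"
    using qvec_inner_interpolation[OF e, of y'] by blast
  define ix where "ix m = Suc (inv_into {..p} e m)" for m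
  have ix: "ix (e (n - 1)) = n" if "1 \<le> n" "n \<le> p + 1" for n
    using that bij_betw_inv_into_left[OF e, of "n - 1"] by (simp add: ix_def)
  define T :: "real ^ 'm \<Rightarrow> real ^ 'm" where "T \<zeta> = (\<chi> m. (qvec p e (ix m) y \<bullet> \<zeta>) / r (ix m))" for \<zeta>
  have "linear T"
    by (rule linearI) (simp_all add: T_def vec_eq_iff inner_add_right add_divide_distrib)
  then have lin: "linear (S \<circ> T)" using S(1) linear_compose by blast
  have C1: "r n * (qvec p e n y' \<bullet> (S \<circ> T) \<zeta>) = qvec p e n y \<bullet> \<zeta>" if "n \<ge> 1" for n \<zeta>
  proof (cases "n \<le> p + 1")
    case True
    then show ?thesis using S(2)[OF that True, of "T \<zeta>"] r[of n]
      unfolding T_def vec_lambda_beta ix[OF that True] by simp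
  qed (simp add: qvec_eq_0)
  have "\<zeta> = 0" if "(S \<circ> T) \<zeta> = 0" for \<zeta>
    using C1[of _ \<zeta>] that by (intro qvec_inner_injective[OF e, where y = y]) simp
  then have "inj (S \<circ> T)" using linear_injective_0[OF lin] by blast
  moreover have "qvec p e n y' \<bullet> S (\<chi> m. h (ix m)) = h n" if "1 \<le> n" "n \<le> p + 1" for n
    using S(2)[OF that, of "\<chi> m. h (ix m)"] ix[OF that] by simp
  ultimately show ?thesis using that[OF lin _ C1] by blast
qed

lemma linear_affine_shear:
  assumes "linear L" "inj L" "\<mu> \<noteq> (0::real)"
  shows "linear (\<lambda>w. (\<mu> * fst w, L (snd w) + fst w *\<^sub>R c))" "inj (\<lambda>w. (\<mu> * fst w, L (snd w) + fst w *\<^sub>R c))"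
proof -
  show "linear (\<lambda>w. (\<mu> * fst w, L (snd w) + fst w *\<^sub>R c))"
    using assms(1) by (auto intro!: linearI simp: linear_add linear_cmul algebra_simps)
  show "inj (\<lambda>w. (\<mu> * fst w, L (snd w) + fst w *\<^sub>R c))"
    using assms(2,3) by (auto intro!: injI simp: prod_eq_iff inj_eq)
qed

section \<open>The exponential potential is homogeneous\<close>

text \<open>
  With \<open>\<zeta>\<close> and \<open>t\<close> the displacements from \<open>w0\<close>, the difference of the two potentials is a function
  \<open>h \<zeta> 0\<close> of \<open>t\<close> from which the exponentials have cancelled. The matching conditions say that its
  derivatives of order at least \<open>2\<close> vanish at \<open>t = 0\<close>, so it is affine in \<open>t\<close>, and that its slope does
  not depend on \<open>\<zeta>\<close>. Its value at \<open>t = 0\<close> is affine in \<open>\<zeta>\<close> since the potential is linear in \<open>z\<close>.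
\<close>

lemma exp_pot_affine_invariance:
  fixes e :: "nat \<Rightarrow> 'm::finite" and w0 w1 :: "'m base"
  assumes e: "bij_betw e {..p} UNIV"
  shows "\<exists>lam A B \<alpha> \<beta>. lam \<noteq> 0 \<and> dual_pair A B \<and>
    (\<forall>w. lam\<^sup>2 * pot p e exp (A w + (w1 - A w0)) = pot p e exp w + \<alpha> \<bullet> w + \<beta>)"
proof -
  obtain y0 z0 y1 z1 where w: "w0 = (y0, z0)" "w1 = (y1, z1)" by (metis surj_pair)
  \<comment> \<open>The choice of \<open>lam\<close> makes \<open>lam\<^sup>2 e\<^sup>y\<close> take equal values at corresponding points.\<close>
  define lam where "lam = exp ((y0 - y1) / 2)"
  have lam: "lam \<noteq> 0" by (simp add: lam_def)
  have "lam\<^sup>2 = exp (y0 - y1)" by (simp add: lam_def power2_eq_square flip: exp_add)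
  then have scale: "lam\<^sup>2 * exp (y1 + t) = exp (y0 + t)" for t by (simp flip: exp_add)
  let ?q = "qvec p e"
  obtain L c where L: "linear L" "inj L"
    and C1: "\<And>n \<zeta>. 1 \<le> n \<Longrightarrow> lam\<^sup>2 * (?q n y1 \<bullet> L \<zeta>) = ?q n y0 \<bullet> \<zeta>"
    and c: "\<And>n. 1 \<le> n \<Longrightarrow> n \<le> p + 1 \<Longrightarrow>
      ?q n y1 \<bullet> c = ((?q (Suc n) y0 \<bullet> z0) / lam\<^sup>2 - ?q (Suc n) y1 \<bullet> z1) / real (Suc n)"
    by (rule jet_transfer_exists[OF e, where r = "\<lambda>_. lam\<^sup>2" and y' = y1 and y = y0
          and h = "\<lambda>n. ((?q (Suc n) y0 \<bullet> z0) / lam\<^sup>2 - ?q (Suc n) y1 \<bullet> z1) / real (Suc n)"])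
      (use lam in simp, blast)
  have C2: "lam\<^sup>2 * (?q (Suc n) y1 \<bullet> z1 + real (Suc n) * (?q n y1 \<bullet> c)) = ?q (Suc n) y0 \<bullet> z0" if "n \<ge> 1" for n
  proof (cases "n \<le> p + 1")
    case True
    have "real (Suc n) * (?q n y1 \<bullet> c) = (?q (Suc n) y0 \<bullet> z0) / lam\<^sup>2 - ?q (Suc n) y1 \<bullet> z1"
      unfolding c[OF that True] by simp
    then show ?thesis using lam by simp
  qed (simp add: qvec_eq_0)
  \<comment> \<open>The \<open>n\<close>-th \<open>t\<close>-derivative of the difference; for \<open>n = 0\<close> the truncated \<open>n - 1\<close> is multiplied by zero.\<close>
  define h where "h \<zeta> n t = lam\<^sup>2 * (?q n (y1 + t) \<bullet> (z1 + L \<zeta>) + t * (?q n (y1 + t) \<bullet> c)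
      + real n * (?q (n - 1) (y1 + t) \<bullet> c)) - ?q n (y0 + t) \<bullet> (z0 + \<zeta>)" for \<zeta> n t
  have q: "((\<lambda>t. ?q n (y + t) \<bullet> z) has_real_derivative ?q (Suc n) (y + t) \<bullet> z) (at t)" for n y z t
    using DERIV_chain2[OF qvec_inner_has_derivative DERIV_add[OF DERIV_const DERIV_ident]] by simp
  have q': "((\<lambda>t. real n * (?q (n - 1) (y1 + t) \<bullet> c)) has_real_derivative real n * (?q n (y1 + t) \<bullet> c)) (at t)" for n t
    by (cases n) (auto intro!: DERIV_cmult q)
  have dh: "(h \<zeta> n has_real_derivative h \<zeta> (Suc n) t) (at t)" for \<zeta> n t
  proof -
    have "(h \<zeta> n has_real_derivative lam\<^sup>2 * (?q (Suc n) (y1 + t) \<bullet> (z1 + L \<zeta>)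
        + (1 * (?q n (y1 + t) \<bullet> c) + (?q (Suc n) (y1 + t) \<bullet> c) * t)
        + real n * (?q n (y1 + t) \<bullet> c)) - ?q (Suc n) (y0 + t) \<bullet> (z0 + \<zeta>)) (at t)"
      unfolding h_def by (intro DERIV_diff DERIV_cmult DERIV_add DERIV_mult DERIV_ident q q')
    then show ?thesis by (simp add: h_def algebra_simps)
  qed
  have h2: "h \<zeta> 2 t = 0" for \<zeta> t
  proof (rule vanishing_by_derivatives[where N = "p + 4" and a = 0 and h = "h \<zeta>"])
    show "h \<zeta> (p + 4) t = 0" for t by (simp add: h_def qvec_eq_0)
    show "h \<zeta> n 0 = 0" if n2: "2 \<le> n" for n
    proof -
      obtain m where "n = Suc m" "m \<ge> 1" using n2 by (cases n) auto
      then show ?thesis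
        using C1[of "Suc m" \<zeta>] C2[of m] by (simp add: h_def inner_add_right algebra_simps)
    qed
  qed (simp_all add: dh)
  define C where "C = h 0 1 0"
  have h1: "h \<zeta> 1 t = C" for \<zeta> t
  proof -
    have "(h \<zeta> 1 has_real_derivative 0) (at t)" for t
      using dh[of \<zeta> 1 t] h2[of \<zeta> t] by (simp add: numeral_2_eq_2)
    then have "h \<zeta> 1 t = h \<zeta> 1 0" by (metis DERIV_isconst_all)
    also have "\<dots> = C"
      using C1[of 1 \<zeta>] linear_0[OF L(1)] by (simp add: h_def C_def inner_add_right algebra_simps)
    finally show ?thesis .
  qed
  define v where "v = lam\<^sup>2 *\<^sub>R adjoint L (?q 0 y1) - ?q 0 y0"
  have h0: "h \<zeta> 0 t = h 0 0 0 + v \<bullet> \<zeta> + C * t" for \<zeta> t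
  proof -
    have "((\<lambda>t. h \<zeta> 0 t - C * t) has_real_derivative h \<zeta> (Suc 0) t - C * 1) (at t)" for t
      by (intro DERIV_diff dh DERIV_cmult DERIV_ident)
    then have "((\<lambda>t. h \<zeta> 0 t - C * t) has_real_derivative 0) (at t)" for t
      using h1[of \<zeta>] by simp
    then have "h \<zeta> 0 t - C * t = h \<zeta> 0 0 - C * 0" by (rule DERIV_isconst_all[rule_format])
    moreover have "adjoint L (?q 0 y1) \<bullet> \<zeta> = ?q 0 y1 \<bullet> L \<zeta>"
      using adjoint_works[OF L(1), of \<zeta> "?q 0 y1"] by (simp add: inner_commute)
    then have "h \<zeta> 0 0 = h 0 0 0 + v \<bullet> \<zeta>"
      using linear_0[OF L(1)] by (simp add: h_def v_def inner_add_right inner_diff_left algebra_simps)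
    ultimately show ?thesis by simp
  qed
  define A where "A w = (1 * fst w, L (snd w) + fst w *\<^sub>R c)" for w :: "'m base"
  have "linear A" "inj A"
    unfolding A_def[abs_def] using linear_affine_shear[OF L, of 1 c] by simp_all
  then obtain B where B: "dual_pair A B" using dual_pair_exists by blast
  have "lam\<^sup>2 * pot p e exp (A w + (w1 - A w0)) = pot p e exp w + (C, v) \<bullet> w + (h 0 0 0 - (C, v) \<bullet> w0)" for w
  proof -
    define t \<zeta> where "t = fst w - y0" and "\<zeta> = snd w - z0"
    have w_eq: "w = (y0 + t, z0 + \<zeta>)" by (simp add: t_def \<zeta>_def)
    have "A w + (w1 - A w0) = (y1 + t, z1 + L \<zeta> + t *\<^sub>R c)"
      by (simp add: A_def w w_eq linear_add[OF L(1)] algebra_simps)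
    then have "lam\<^sup>2 * pot p e exp (A w + (w1 - A w0)) - pot p e exp w = h \<zeta> 0 t"
      unfolding pot_eq w_eq by (simp add: h_def inner_add_right distrib_left scale)
    moreover have "(C, v) \<bullet> w - (C, v) \<bullet> w0 = v \<bullet> \<zeta> + C * t"
      by (simp add: w w_eq inner_add_right algebra_simps)
    ultimately show ?thesis using h0[of \<zeta> t] by linarith
  qed
  then show ?thesis using lam B by blast
qed

lemma homogeneous_exp:
  fixes e :: "nat \<Rightarrow> 'm::finite"
  assumes "bij_betw e {..p} UNIV"
  shows "homogeneous (pp_metric (pot p e exp))"
  unfolding homogeneous_def
proof (intro allI)
  fix P Q :: "'m point"
  obtain lam A B \<alpha> \<beta> where *: "lam \<noteq> 0" "dual_pair A B"
    "\<And>w. lam\<^sup>2 * pot p e exp (A w + (wc Q - A (wc P))) = pot p e exp w + \<alpha> \<bullet> w + \<beta>"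
    using exp_pot_affine_invariance[OF assms, of "wc Q" "wc P"] by blast
  let ?a = "xc Q - lam * xc P"
  let ?a' = "xb Q - (xb P + xc P * (\<alpha> \<bullet> wc P) + \<beta> * xc P) / lam"
  let ?b' = "wb Q - B (wb P - ((xc P)\<^sup>2 / 2) *\<^sub>R \<alpha>)"
  show "\<exists>\<phi>. is_isometry (pp_metric (pot p e exp)) \<phi> \<and> \<phi> P = Q"
    by (rule exI, rule conjI, rule is_isometry_pp_metric[OF *, where a = ?a and a' = ?a' and b' = ?b'])
      (simp only: point_eq_iff, simp)
qed

section \<open>The sum of exponentials is modeled on the exponential\<close>

text \<open>
  The \<open>n\<close>-th derivative of \<open>e\<^sup>y + e\<^sup>2\<^sup>y\<close>.
\<close>

definition exp_sum :: "nat \<Rightarrow> real \<Rightarrow> real" where "exp_sum n y = exp y + 2 ^ n * exp (2 * y)"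

lemma derivative_tower_exp: "derivative_tower (pot p e exp) (jet p e (\<lambda>_. exp))"
  by (rule derivative_tower_jet) (rule DERIV_exp)

lemma derivative_tower_exp_sum: "derivative_tower (pot p e (\<lambda>y. exp y + exp (2 * y))) (jet p e exp_sum)"
proof -
  have "derivative_tower (pot p e (exp_sum 0)) (jet p e exp_sum)"
    by (rule derivative_tower_jet) (auto simp: exp_sum_def[abs_def] intro!: derivative_eq_intros)
  then show ?thesis by (simp add: exp_sum_def[abs_def])
qed

lemma exp_sum_pos: "exp_sum n y > 0"
  by (simp add: exp_sum_def add_pos_pos)

text \<open>
  Orders \<open>2, \<dots>, p + 2\<close> of the potential are matched by the shear \<open>c\<close>, and orders \<open>p + 3\<close> and \<open>p + 4\<close> by
  the scales \<open>lam\<close> and \<open>\<mu>\<close>. Positivity of the derivatives allows the square root in \<open>lam\<close>.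
\<close>

lemma exp_sum_modeled_on_exp:
  fixes e :: "nat \<Rightarrow> 'm::finite"
  assumes e: "bij_betw e {..p} UNIV"
  shows "k_modeled (p + 2) (pp_metric (pot p e (\<lambda>y. exp y + exp (2 * y)))) (pp_metric (pot p e exp))"
  unfolding k_modeled_def
proof (intro conjI allI)
  show "homogeneous (pp_metric (pot p e exp))" using e by (rule homogeneous_exp)
next
  fix P Q :: "'m point"
  let ?q = "qvec p e"
  define y z y' z' where "y = fst (wc P)" "z = snd (wc P)" "y' = fst (wc Q)" "z' = snd (wc Q)"
  note yz = this
  \<comment> \<open>All derivatives of the exponential agree, so \<open>\<mu>\<close> must be the ratio of the two derivatives to be matched.\<close>
  define \<mu> where "\<mu> = exp_sum (p + 4) y / exp_sum (p + 3) y"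
  define lam where "lam = sqrt (exp_sum (p + 3) y / (\<mu> ^ (p + 3) * exp y'))"
  have \<mu>: "\<mu> > 0" by (simp add: \<mu>_def exp_sum_pos)
  have lam2: "lam\<^sup>2 = exp_sum (p + 3) y / (\<mu> ^ (p + 3) * exp y')"
    unfolding lam_def using \<mu> by (intro real_sqrt_pow2) (simp add: exp_sum_pos less_imp_le)
  then have "lam\<^sup>2 > 0" using \<mu> exp_sum_pos by simp
  then have lam: "lam \<noteq> 0" by auto
  have top3: "lam\<^sup>2 * \<mu> ^ (p + 3) * exp y' = exp_sum (p + 3) y" using lam2 \<mu> by simp
  have "lam\<^sup>2 * \<mu> ^ (p + 4) * exp y' = \<mu> * (lam\<^sup>2 * \<mu> ^ (p + 3) * exp y')"
    by (simp add: eval_nat_numeral)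
  also have "\<dots> = exp_sum (p + 4) y"
    unfolding top3 using exp_sum_pos[of "p + 3" y] by (simp add: \<mu>_def)
  finally have top4: "lam\<^sup>2 * \<mu> ^ (p + 4) * exp y' = exp_sum (p + 4) y" .
  obtain L c where L: "linear L" "inj L"
    and C1: "\<And>n \<zeta>. 1 \<le> n \<Longrightarrow> lam\<^sup>2 * \<mu> ^ n * (?q n y' \<bullet> L \<zeta>) = ?q n y \<bullet> \<zeta>"
    and c: "\<And>n. 1 \<le> n \<Longrightarrow> n \<le> p + 1 \<Longrightarrow> ?q n y' \<bullet> c =
      ((exp_sum (Suc n) y + ?q (Suc n) y \<bullet> z) / (lam\<^sup>2 * \<mu> ^ n) - (exp y' + ?q (Suc n) y' \<bullet> z') * \<mu>) / real (Suc n)"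
    by (rule jet_transfer_exists[OF e, where r = "\<lambda>n. lam\<^sup>2 * \<mu> ^ n" and y' = y' and y = y
          and h = "\<lambda>n. ((exp_sum (Suc n) y + ?q (Suc n) y \<bullet> z) / (lam\<^sup>2 * \<mu> ^ n)
            - (exp y' + ?q (Suc n) y' \<bullet> z') * \<mu>) / real (Suc n)"])
      (use lam \<mu> in simp, blast)
  have C2: "lam\<^sup>2 * \<mu> ^ n * ((exp y' + ?q (Suc n) y' \<bullet> z') * \<mu> + real (Suc n) * (?q n y' \<bullet> c))
      = exp_sum (Suc n) y + ?q (Suc n) y \<bullet> z" if n: "1 \<le> n" "n \<le> p + 3" for n
  proof -
    consider "n \<le> p + 1" | "n = p + 2" | "n = p + 3" using n by linarith
    then show ?thesis
    proof cases
      case 1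
      have "real (Suc n) * (?q n y' \<bullet> c) =
          (exp_sum (Suc n) y + ?q (Suc n) y \<bullet> z) / (lam\<^sup>2 * \<mu> ^ n) - (exp y' + ?q (Suc n) y' \<bullet> z') * \<mu>"
        unfolding c[OF n(1) 1] by simp
      then show ?thesis using lam \<mu> by simp
    next
      case 2
      then show ?thesis using top3 by (simp add: qvec_eq_0 eval_nat_numeral algebra_simps)
    next
      case 3
      then show ?thesis using top4 by (simp add: qvec_eq_0 eval_nat_numeral algebra_simps)
    qed
  qed
  define A where "A w = (\<mu> * fst w, L (snd w) + fst w *\<^sub>R c)" for w :: "'m base"
  have "linear A" "inj A"
    unfolding A_def[abs_def] using linear_affine_shear[OF L, of \<mu> c] \<mu> by simp_all
  then obtain B where B: "dual_pair A B" using dual_pair_exists by blast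
  show "\<exists>\<phi>. linear \<phi> \<and> bij \<phi> \<and>
      (\<forall>u v. pp_metric (pot p e exp) Q (\<phi> u) (\<phi> v) = pp_metric (pot p e (\<lambda>y. exp y + exp (2 * y))) P u v) \<and>
      (\<forall>i\<le>p + 2. \<forall>us. length us = i + 4 \<longrightarrow>
        nabla_curv04 i (pp_metric (pot p e exp)) Q (map \<phi> us) =
        nabla_curv04 i (pp_metric (pot p e (\<lambda>y. exp y + exp (2 * y)))) P us)"
  proof (rule linear_model[OF derivative_tower_exp_sum derivative_tower_exp lam B])
    fix ws :: "'m base list" and t
    assume n: "1 \<le> length ws" "length ws \<le> p + 2 + 1"
    show "lam\<^sup>2 * (jet p e (\<lambda>_. exp) (wc Q) (map A ws) \<bullet> A t) = jet p e exp_sum (wc P) ws \<bullet> t"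
      unfolding A_def[abs_def]
    proof (rule jet_map[OF _ refl])
      show "\<mu> \<noteq> 0" using \<mu> by simp
    qed (use C1[of "length ws"] C2[of "length ws"] n in \<open>simp_all add: yz\<close>)
  qed
qed

section \<open>The affine invariant\<close>

lemma cross_terms_qvec_0: "qvec p e k y = 0 \<Longrightarrow> cross_terms p e k y ws = 0"
  by (induction ws) simp_all

text \<open>
  From order \<open>n = p + 1\<close> on, the polynomial part of the potential contributes nothing to \<open>\<nabla>\<^sup>n R\<close>,
  and what is left is the scalar \<open>f\<^sup>(\<^sup>n\<^sup>+\<^sup>2\<^sup>)(y)\<close> times a tensor that does not depend on the point.
\<close>

lemma nabla_curv13_high_order:
  assumes "derivative_tower F (jet p e fd)" and vs: "length vs = n" and n: "p + 1 \<le> n"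
  shows "nabla_curv13 n (pp_metric F) P (vs @ [a, b, c]) =
    (fd (n + 2) (fst (wc P)) * prod_list (map (\<lambda>v. fst (wc v)) vs)
      * (xc b * fst (wc a) - xc a * fst (wc b))) *\<^sub>R curv_apply (1, 0) c"
proof -
  interpret derivative_tower F "jet p e fd" by fact
  have "qvec p e (Suc n) y = 0" "qvec p e (Suc (Suc n)) y = 0" for y
    using n by (simp_all add: qvec_eq_0)
  then have jet: "jet p e fd (wc P) (map wc vs @ [wc v]) =
      (fd (n + 2) (fst (wc P)) * prod_list (map (\<lambda>v. fst (wc v)) vs) * fst (wc v), 0)" for v
    using vs by (simp add: jet_def Let_def cross_terms_qvec_0 o_def)
  have "curv_form P vs a b = (fd (n + 2) (fst (wc P)) * prod_list (map (\<lambda>v. fst (wc v)) vs)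
      * (xc b * fst (wc a) - xc a * fst (wc b)), 0)"
    unfolding curv_form_def jet by (simp add: algebra_simps)
  moreover have "curv_apply (s, 0) c = s *\<^sub>R curv_apply (1, 0) c" for s
    by (simp only: point_eq_iff) (simp add: curv_apply_def inner_prod_def)
  ultimately show ?thesis using nabla_curv13_eq[OF vs] by metis
qed

text \<open>
  Fill all slots with \<open>\<partial>\<^sub>y\<close> except the last two, which get \<open>\<partial>\<^sub>x\<close>. For \<open>n = p + 1, p + 2, p + 3\<close> an
  intertwining map \<open>\<phi>\<close> then satisfies \<open>f\<^sup>(\<^sup>n\<^sup>+\<^sup>2\<^sup>)(y') \<mu>\<^sup>n X' = f\<^sup>(\<^sup>n\<^sup>+\<^sup>2\<^sup>)(y) X\<close>, where the number \<open>\<mu>\<close> and the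
  vectors \<open>X', X \<noteq> 0\<close> are the same for the three values of \<open>n\<close>. The product of the outer two equations
  against the square of the middle one eliminates \<open>\<mu>\<close> and \<open>X'\<close>.
\<close>

lemma affine_invariant:
  fixes e :: "nat \<Rightarrow> 'm::finite"
  assumes T: "derivative_tower F (jet p e fd)" and hom: "affine_curvature_homogeneous (p + 3) (pp_metric F)"
  shows "fd (p + 3) y * fd (p + 5) y * (fd (p + 4) y')\<^sup>2 = fd (p + 3) y' * fd (p + 5) y' * (fd (p + 4) y)\<^sup>2"
proof -
  interpret derivative_tower F "jet p e fd" by fact
  define pt :: "real \<Rightarrow> 'm point" where "pt y = mk_pt 0 (y, 0) 0 0" for y
  define ex ey :: "'m point" where "ex = mk_pt 1 0 0 0" and "ey = mk_pt 0 (1, 0) 0 0"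
  obtain \<phi> where \<phi>: "linear \<phi>" "bij \<phi>"
    and eq: "\<And>i us. i \<le> p + 3 \<Longrightarrow> length us = i + 3 \<Longrightarrow>
      nabla_curv13 i (pp_metric F) (pt y') (map \<phi> us) = \<phi> (nabla_curv13 i (pp_metric F) (pt y) us)"
    using hom unfolding affine_curvature_homogeneous_def by metis
  define X where "X = \<phi> (curv_apply (1, 0) ex)"
  define X' where "X' = (xc (\<phi> ex) * fst (wc (\<phi> ey)) - xc (\<phi> ey) * fst (wc (\<phi> ex))) *\<^sub>R curv_apply (1, 0) (\<phi> ex)"
  define \<mu> where "\<mu> = fst (wc (\<phi> ey))"
  define a a' where "a = X \<bullet> X" and "a' = X' \<bullet> X"
  have key: "fd (n + 2) y' * \<mu> ^ n * a' = fd (n + 2) y * a" if "p + 1 \<le> n" "n \<le> p + 3" for n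
  proof -
    let ?us = "replicate n ey @ [ey, ex, ex]"
    have "nabla_curv13 n (pp_metric F) (pt y) ?us = fd (n + 2) y *\<^sub>R curv_apply (1, 0) ex"
      using nabla_curv13_high_order[OF T _ that(1), of "replicate n ey" "pt y" ey ex ex]
      by (simp add: pt_def ex_def ey_def)
    moreover have "nabla_curv13 n (pp_metric F) (pt y') (map \<phi> ?us) = (fd (n + 2) y' * \<mu> ^ n) *\<^sub>R X'"
      using nabla_curv13_high_order[OF T _ that(1), of "replicate n (\<phi> ey)" "pt y'" "\<phi> ey" "\<phi> ex" "\<phi> ex"]
      by (simp add: pt_def \<mu>_def X'_def)
    ultimately have "(fd (n + 2) y' * \<mu> ^ n) *\<^sub>R X' = fd (n + 2) y *\<^sub>R X"
      using eq[of n ?us] that by (simp add: X_def linear_cmul[OF \<phi>(1)])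
    then have "((fd (n + 2) y' * \<mu> ^ n) *\<^sub>R X') \<bullet> X = (fd (n + 2) y *\<^sub>R X) \<bullet> X" by simp
    then show ?thesis by (simp add: a_def a'_def)
  qed
  have "wb (curv_apply (1, 0) ex) \<noteq> wb 0" by (simp add: curv_apply_def ex_def prod_eq_iff)
  then have "X \<noteq> 0"
    unfolding X_def using \<phi> by (metis bij_is_inj inj_eq linear_0)
  then have "a \<noteq> 0" by (simp add: a_def)
  define K where "K = \<mu> ^ (p + 2) * a'"
  have k: "fd (p + 4) y' * K = fd (p + 4) y * a"
    using key[of "p + 2"] by (simp add: K_def eval_nat_numeral algebra_simps)
  have "(fd (p + 3) y' * \<mu> ^ (p + 1) * a') * (fd (p + 5) y' * \<mu> ^ (p + 3) * a') =
      (fd (p + 3) y * a) * (fd (p + 5) y * a)"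
    using key[of "p + 1"] key[of "p + 3"] by (simp add: eval_nat_numeral)
  then have k2: "fd (p + 3) y' * fd (p + 5) y' * K\<^sup>2 = fd (p + 3) y * fd (p + 5) y * a\<^sup>2"
    by (simp add: K_def power2_eq_square eval_nat_numeral algebra_simps)
  have "(fd (p + 3) y * fd (p + 5) y * (fd (p + 4) y')\<^sup>2) * a\<^sup>2 =
      (fd (p + 4) y')\<^sup>2 * (fd (p + 3) y' * fd (p + 5) y' * K\<^sup>2)"
    unfolding k2 by simp
  also have "\<dots> = fd (p + 3) y' * fd (p + 5) y' * (fd (p + 4) y' * K)\<^sup>2"
    by (simp add: power_mult_distrib)
  also have "\<dots> = (fd (p + 3) y' * fd (p + 5) y' * (fd (p + 4) y)\<^sup>2) * a\<^sup>2"
    unfolding k by (simp add: power_mult_distrib)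
  finally show ?thesis using \<open>a \<noteq> 0\<close> by simp
qed

text \<open>
  With \<open>u = 2\<^sup>p\<^sup>+\<^sup>3 e\<^sup>y\<close>, the derivatives of order \<open>p + 3, p + 4, p + 5\<close> are \<open>e\<^sup>y\<close> times \<open>1 + u\<close>, \<open>1 + 2 u\<close>
  and \<open>1 + 4 u\<close>. The invariant \<open>(1 + u)(1 + 4 u) / (1 + 2 u)\<^sup>2\<close> is \<open>10/9\<close> at \<open>u = 1\<close> and \<open>27/25\<close> at
  \<open>u = 2\<close>.
\<close>

lemma exp_sum_not_affine_homogeneous:
  fixes e :: "nat \<Rightarrow> 'm::finite"
  shows "\<not> affine_curvature_homogeneous (p + 3) (pp_metric (pot p e (\<lambda>y. exp y + exp (2 * y))))"
proof
  assume hom: "affine_curvature_homogeneous (p + 3) (pp_metric (pot p e (\<lambda>y. exp y + exp (2 * y))))"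
  \<comment> \<open>The value of \<open>y\<close> at which \<open>2\<^sup>p\<^sup>+\<^sup>3 e\<^sup>y = u\<close>.\<close>
  define Y where "Y u = ln (u / 2 ^ (p + 3))" for u :: real
  have val: "exp_sum (p + 3 + j) (Y u) = exp (Y u) * (1 + 2 ^ j * u)" if "u > 0" for u j
  proof -
    have "exp (2 * Y u) = exp (Y u) * (u / 2 ^ (p + 3))"
      using that by (simp only: mult_2 exp_add) (simp add: Y_def)
    then show ?thesis by (simp add: exp_sum_def power_add algebra_simps)
  qed
  have "exp_sum (p + 3) (Y 1) * exp_sum (p + 5) (Y 1) * (exp_sum (p + 4) (Y 2))\<^sup>2 =
      exp_sum (p + 3) (Y 2) * exp_sum (p + 5) (Y 2) * (exp_sum (p + 4) (Y 1))\<^sup>2"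
    by (rule affine_invariant[OF derivative_tower_exp_sum hom])
  then have "250 * ((exp (Y 1))\<^sup>2 * (exp (Y 2))\<^sup>2) = 243 * ((exp (Y 1))\<^sup>2 * (exp (Y 2))\<^sup>2)"
    using val[of 1 0] val[of 1 1] val[of 1 2] val[of 2 0] val[of 2 1] val[of 2 2]
    by (simp add: power2_eq_square algebra_simps)
  then show False by simp
qed

theorem theorem1p4:
  fixes p :: nat and e :: "nat \<Rightarrow> 'm::finite"
  assumes "bij_betw e {..p} (UNIV :: 'm set)"
  shows "homogeneous (g_met p e (\<lambda>y. exp y)) \<and>
         k_modeled (p + 2) (g_met p e (\<lambda>y. exp y + exp (2 * y))) (g_met p e (\<lambda>y. exp y)) \<and>
         \<not> affine_curvature_homogeneous (p + 3) (g_met p e (\<lambda>y. exp y + exp (2 * y)))"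
  unfolding g_met_eq_pp_metric
  by (intro conjI homogeneous_exp exp_sum_modeled_on_exp exp_sum_not_affine_homogeneous assms)

end
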